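(* Let $G=G_1\sqcup\cdots\sqcup G_k$ be a cluster graph, where $G_1,\dots,G_k$ are complete graphs, and let $D_l$ be the product of the numbers of pure strategies of the players in $G_l$. Let $\mathcal S$ be the set of isolated vertices of $G$, and for $i\in\mathcal S$ let $d_i$ be the number of pure strategies of player $i$. Then the Nash CI variety $\mathcal V_{X,G}$ is nonempty for a generic game $X$ if and only if $$d_i\le 1+\frac12\sum_{l=1}^k(D_l-1)\qquad\text{for every } i\in\mathcal S.$$
   Context: Write $[d]=\{1,\dots,d\}$ and $\mathcal R_C=\prod_{i\in C}[d_i]$ for $C\subseteq[n]$. There are $n$ players, player $i$ having $d_i\ge2$ pure strategies. A $d_1\times\cdots\times d_n$ game is a tuple $X=(X^{(1)},\dots,X^{(n)})$ of real tensors $X^{(i)}=(X^{(i)}_{j_1\cdots j_n})\in\mathbb R^{d_1\times\cdots\times d_n}$. A statement holds for a generic game if it holds for all $X$ in a nonempty Zariski open subset of $(\mathbb R^{d_1\times\cdots\times d_n})^n$. Let $\mathbb P^{d_1\cdots d_n-1}$ be complex projective space with coordinates $p_{j_1\cdots j_n}$. An index replaced by $+$ means summation over that index. Spohn variety: $\mathcal V_X\subseteq\mathbb P^{d_1\cdots d_n-1}$ is the common vanishing set, over all players $i\in[n]$, of the $2\times2$ minors of the $d_i\times 2$ matrix $M^{(i)}$ whose $r$-th row ($r\in[d_i]$) is $\big(p_{+\cdots+r+\cdots+},\ \sum_{j:\,j_i=r}X^{(i)}_{j_1\cdots j_n}p_{j_1\cdots j_n}\big)$, with $r$ in position $i$.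 For an undirected graph $G$ on $[n]$ with set of maximal cliques $\mathcal C(G)$, $\mathcal M_G\subseteq\mathbb P^{d_1\cdots d_n-1}$ is the projective toric variety that is the Zariski closure of the image of the parametrization $p_{j_1\cdots j_n}=\prod_{C\in\mathcal C(G)}\sigma^{(C)}_{j_C}$, with $\sigma^{(C)}\in\mathbb C^{\mathcal R_C}$ and $j_C=(j_i)_{i\in C}$. The Spohn CI variety $\mathcal V_{X,G}$ is the Zariski closure of $(\mathcal V_X\cap\mathcal M_G)\setminus\mathcal W$, where $\mathcal W$ is the union of the hyperplanes $\{p_j=0\}$ for $j\in\mathcal R_{[n]}$ and the hyperplane $\{p_{+\cdots+}=0\}$. A cluster graph is a graph all of whose connected components are complete graphs; when $G$ is a cluster graph, $\mathcal V_{X,G}$ is called the Nash CI variety, and $\mathcal M_G$ is the Segre variety $\mathbb P^{D_1-1}\times\cdots\times\mathbb P^{D_k-1}$. *)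

theory Defs
  imports Complex_Main "HOL-Library.FuncSet" "HOL-Library.Poly_Mapping"
    "Graph_Theory.Graph_Theory"
begin

section \<open>Polynomials and the Zariski topology\<close>

text \<open>A polynomial in variables of type \<open>'v\<close> is an element of the monoid algebra
  \<open>('v \<Rightarrow>\<^sub>0 nat) \<Rightarrow>\<^sub>0 'a\<close>. Affine space with coordinates indexed by the finite set \<open>V\<close> is the
  set \<open>V \<rightarrow>\<^sub>E UNIV\<close>.\<close>

definition poly_eval :: "(('v \<Rightarrow>\<^sub>0 nat) \<Rightarrow>\<^sub>0 'a::comm_ring_1) \<Rightarrow> ('v \<Rightarrow> 'a) \<Rightarrow> 'a" where
  "poly_eval f x =
     (\<Sum>m\<in>Poly_Mapping.keys f. Poly_Mapping.lookup f m *
        (\<Prod>v\<in>Poly_Mapping.keys m. x v ^ Poly_Mapping.lookup m v))"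

definition polys_in :: "'v set \<Rightarrow> (('v \<Rightarrow>\<^sub>0 nat) \<Rightarrow>\<^sub>0 'a::comm_ring_1) set" where
  "polys_in V = {f. \<forall>m\<in>Poly_Mapping.keys f. Poly_Mapping.keys m \<subseteq> V}"

definition homogeneous :: "nat \<Rightarrow> (('v \<Rightarrow>\<^sub>0 nat) \<Rightarrow>\<^sub>0 'a::comm_ring_1) \<Rightarrow> bool" where
  "homogeneous e f \<longleftrightarrow>
     (\<forall>m\<in>Poly_Mapping.keys f. (\<Sum>v\<in>Poly_Mapping.keys m. Poly_Mapping.lookup m v) = e)"

definition affine_zariski_closed :: "'v set \<Rightarrow> ('v \<Rightarrow> 'a::field) set \<Rightarrow> bool" where
  "affine_zariski_closed V Z \<longleftrightarrow>
     (\<exists>F \<subseteq> polys_in V. Z = {x \<in> V \<rightarrow>\<^sub>E UNIV. \<forall>f\<in>F. poly_eval f x = 0})"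

definition affine_zariski_open :: "'v set \<Rightarrow> ('v \<Rightarrow> 'a::field) set \<Rightarrow> bool" where
  "affine_zariski_open V U \<longleftrightarrow>
     U \<subseteq> (V \<rightarrow>\<^sub>E UNIV) \<and> affine_zariski_closed V ((V \<rightarrow>\<^sub>E UNIV) - U)"

definition holds_generically :: "'v set \<Rightarrow> (('v \<Rightarrow> 'a::field) \<Rightarrow> bool) \<Rightarrow> bool" where
  "holds_generically V P \<longleftrightarrow> (\<exists>U. affine_zariski_open V U \<and> U \<noteq> {} \<and> (\<forall>x\<in>U. P x))"

text \<open>Projective space with homogeneous coordinates indexed by \<open>J\<close>: nonzero coordinate
  vectors modulo nonzero scalars. A point is the set of all its coordinate vectors.\<close>

definition nonzero_vecs :: "'j set \<Rightarrow> ('j \<Rightarrow> 'a::field) set" where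
  "nonzero_vecs J = {p \<in> J \<rightarrow>\<^sub>E UNIV. \<exists>j\<in>J. p j \<noteq> 0}"

definition proportional :: "'j set \<Rightarrow> (('j \<Rightarrow> 'a::field) \<times> ('j \<Rightarrow> 'a)) set" where
  "proportional J =
     {(p, q). p \<in> nonzero_vecs J \<and> q \<in> nonzero_vecs J \<and> (\<exists>c. c \<noteq> 0 \<and> (\<forall>j\<in>J. q j = c * p j))}"

definition proj_space :: "'j set \<Rightarrow> ('j \<Rightarrow> 'a::field) set set" where
  "proj_space J = nonzero_vecs J // proportional J"

definition proj_zariski_closed :: "'j set \<Rightarrow> ('j \<Rightarrow> 'a::field) set set \<Rightarrow> bool" where
  "proj_zariski_closed J Z \<longleftrightarrow>
     (\<exists>F. F \<subseteq> polys_in J \<and> (\<forall>f\<in>F. \<exists>e. homogeneous e f) \<and>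
        Z = {P \<in> proj_space J. \<forall>f\<in>F. \<forall>p\<in>P. poly_eval f p = 0})"

definition proj_zariski_closure :: "'j set \<Rightarrow> ('j \<Rightarrow> 'a::field) set set \<Rightarrow> ('j \<Rightarrow> 'a) set set" where
  "proj_zariski_closure J A = proj_zariski_closed J hull A"


section \<open>Graphs\<close>

text \<open>Undirected graphs are symmetric loop-free digraphs (locale \<open>pair_graph\<close>); the connected
  components of such a graph are its strongly connected components \<open>sccs\<close>.\<close>

definition components :: "'a pair_pre_digraph \<Rightarrow> ('a, 'a \<times> 'a) pre_digraph set" where
  "components G = pre_digraph.sccs (with_proj G)"

definition cluster_graph :: "'a pair_pre_digraph \<Rightarrow> bool" where
  "cluster_graph G \<longleftrightarrow> pair_graph G \<and> (\<forall>H\<in>components G. complete_digraph (card (verts H)) H)"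

definition isolated_vertices :: "'a pair_pre_digraph \<Rightarrow> 'a set" where
  "isolated_vertices G = {v \<in> pverts G. \<forall>w. (v, w) \<notin> parcs G}"

definition clique :: "'a pair_pre_digraph \<Rightarrow> 'a set \<Rightarrow> bool" where
  "clique G C \<longleftrightarrow> C \<subseteq> pverts G \<and> (\<forall>u\<in>C. \<forall>v\<in>C. u \<noteq> v \<longrightarrow> (u, v) \<in> parcs G)"

definition max_cliques :: "'a pair_pre_digraph \<Rightarrow> 'a set set" where
  "max_cliques G = {C. clique G C \<and> (\<forall>C'. clique G C' \<and> C \<subseteq> C' \<longrightarrow> C' = C)}"


section \<open>Games and Spohn varieties\<close>

text \<open>The players are \<open>1, \<dots>, n\<close>, the pure strategies of player \<open>i\<close> are \<open>1, \<dots>, d i\<close>.\<close>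

definition profiles :: "(nat \<Rightarrow> nat) \<Rightarrow> nat set \<Rightarrow> (nat \<Rightarrow> nat) set" where
  "profiles d C = (\<Pi>\<^sub>E i\<in>C. {1..d i})"

text \<open>A game assigns to \<open>(i, j)\<close> the payoff of player \<open>i\<close> at the profile \<open>j\<close>; the space of
  games is \<open>game_coords n d \<rightarrow>\<^sub>E UNIV\<close>.\<close>

definition game_coords :: "nat \<Rightarrow> (nat \<Rightarrow> nat) \<Rightarrow> (nat \<times> (nat \<Rightarrow> nat)) set" where
  "game_coords n d = {1..n} \<times> profiles d {1..n}"

type_synonym game = "nat \<times> (nat \<Rightarrow> nat) \<Rightarrow> real"
type_synonym point = "((nat \<Rightarrow> nat) \<Rightarrow> complex) set"

abbreviation ambient :: "nat \<Rightarrow> (nat \<Rightarrow> nat) \<Rightarrow> point set" where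
  "ambient n d \<equiv> proj_space (profiles d {1..n})"

definition spohn_row ::
    "nat \<Rightarrow> (nat \<Rightarrow> nat) \<Rightarrow> game \<Rightarrow> ((nat \<Rightarrow> nat) \<Rightarrow> complex) \<Rightarrow> nat \<Rightarrow> nat \<Rightarrow> complex \<times> complex" where
  "spohn_row n d X p i r =
     (\<Sum>j\<in>{j \<in> profiles d {1..n}. j i = r}. p j,
      \<Sum>j\<in>{j \<in> profiles d {1..n}. j i = r}. complex_of_real (X (i, j)) * p j)"

definition minor2 :: "'a \<times> 'a \<Rightarrow> 'a \<times> 'a \<Rightarrow> 'a::comm_ring" where
  "minor2 a b = fst a * snd b - snd a * fst b"

definition spohn_variety :: "nat \<Rightarrow> (nat \<Rightarrow> nat) \<Rightarrow> game \<Rightarrow> point set" where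
  "spohn_variety n d X =
     {P \<in> ambient n d. \<forall>p\<in>P. \<forall>i\<in>{1..n}. \<forall>r\<in>{1..d i}. \<forall>s\<in>{1..d i}.
        minor2 (spohn_row n d X p i r) (spohn_row n d X p i s) = 0}"

text \<open>Parameters \<open>\<sigma>\<close> for which the product vanishes at every profile define no point of
  projective space and are excluded, since the zero vector lies in no \<open>P\<close>.\<close>

definition graph_model :: "nat \<Rightarrow> (nat \<Rightarrow> nat) \<Rightarrow> nat pair_pre_digraph \<Rightarrow> point set" where
  "graph_model n d G = proj_zariski_closure (profiles d {1..n})
     {P \<in> ambient n d. \<exists>\<sigma> :: nat set \<Rightarrow> (nat \<Rightarrow> nat) \<Rightarrow> complex.
        (\<lambda>j\<in>profiles d {1..n}. \<Prod>C\<in>max_cliques G. \<sigma> C (restrict j C)) \<in> P}"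

definition special_hyperplanes :: "nat \<Rightarrow> (nat \<Rightarrow> nat) \<Rightarrow> point set" where
  "special_hyperplanes n d =
     (\<Union>j\<in>profiles d {1..n}. {P \<in> ambient n d. \<forall>p\<in>P. p j = 0}) \<union>
     {P \<in> ambient n d. \<forall>p\<in>P. (\<Sum>j\<in>profiles d {1..n}. p j) = 0}"

definition spohn_CI_variety ::
    "nat \<Rightarrow> (nat \<Rightarrow> nat) \<Rightarrow> game \<Rightarrow> nat pair_pre_digraph \<Rightarrow> point set" where
  "spohn_CI_variety n d X G = proj_zariski_closure (profiles d {1..n})
     ((spohn_variety n d X \<inter> graph_model n d G) - special_hyperplanes n d)"

end

theory Submission
  imports Defs "HOL-Computational_Algebra.Fundamental_Theorem_Algebra"
begin

text \<open>Off \<open>\<W>\<close> a point of the Segre variety is a product of vectors \<open>\<sigma> C\<close>, one for each component \<open>C\<close>, and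
  the minors of an isolated player \<open>i\<close> become \<open>d i - 1\<close> equations that are linear in the payoffs and
  multilinear in the \<open>\<sigma> C\<close> with \<open>C \<noteq> {i}\<close>.

  If there are more equations than the dimension of the product of the other projective spaces,
  some game has no solution there: take as equations the coefficients of a product of univariate
  polynomials. By compactness all games near it have no solution either, and these are Zariski dense.

  Conversely, the set of complex games with a solution is constructible, hence it contains a
  nonempty Zariski open set as soon as no nonzero polynomial vanishes on it. To see the latter, start at
  a game \<open>X0\<close> solved by \<open>\<sigma> = 1\<close> at which the equations can be solved to first order in every direction.
  In \<open>X0\<close> every equation involves a single difference of coordinates of \<open>\<sigma>\<close>, and the
  inequalities for the isolated players are what is needed to choose these differences independently.\<close>

section \<open>Polynomial functions and constructible sets\<close>

text \<open>The factor 1/2 arises because the sum over all components contains the term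
  \<open>d i - 1\<close> of the isolated player itself. Moved to the other side, the inequality says
  that \<open>d i - 1\<close> is at most the sum of \<open>D_l - 1\<close> over the other
  components. A player in a larger component causes no inequality: its equations may involve
  coordinates of its own component, and the profiles \<open>unit i r\<close> there are distinct for
  all players of that component.

  Two obstacles shape the proof. A limit of solutions may fall into the coordinate hyperplanes, so
  the game without solutions has to exclude all parameters that are nonzero in each other block,
  even if some of their coordinates vanish. And payoffs are real while points are complex:
  elimination and dominance take place over the complex numbers, and only at the end is the
  resulting polynomial restricted to real games.

  Polynomials are treated as functions generated from constants and coordinates, which turns
  substitution, continuity and the splitting into real and imaginary parts into inductions.\<close>

inductive_set poly_fun :: "'v set \<Rightarrow> (('v \<Rightarrow> 'a::comm_ring_1) \<Rightarrow> 'a) set" for V where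
  poly_fun_const: "(\<lambda>x. c) \<in> poly_fun V"
| poly_fun_var: "v \<in> V \<Longrightarrow> (\<lambda>x. x v) \<in> poly_fun V"
| poly_fun_add: "f \<in> poly_fun V \<Longrightarrow> g \<in> poly_fun V \<Longrightarrow> (\<lambda>x. f x + g x) \<in> poly_fun V"
| poly_fun_mult: "f \<in> poly_fun V \<Longrightarrow> g \<in> poly_fun V \<Longrightarrow> (\<lambda>x. f x * g x) \<in> poly_fun V"

lemma poly_fun_diff: "f \<in> poly_fun V \<Longrightarrow> g \<in> poly_fun V \<Longrightarrow> (\<lambda>x. f x - g x) \<in> poly_fun V"
  using poly_fun_add[of f V "\<lambda>x. (-1) * g x"] poly_fun_mult[OF poly_fun_const[of "-1"], of g V] by simp

lemma poly_fun_sum: "(\<And>i. i \<in> I \<Longrightarrow> f i \<in> poly_fun V) \<Longrightarrow> (\<lambda>x. \<Sum>i\<in>I. f i x) \<in> poly_fun V"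
  by (induction I rule: infinite_finite_induct) (auto intro: poly_fun_const poly_fun_add)

lemma poly_fun_prod: "(\<And>i. i \<in> I \<Longrightarrow> f i \<in> poly_fun V) \<Longrightarrow> (\<lambda>x. \<Prod>i\<in>I. f i x) \<in> poly_fun V"
  by (induction I rule: infinite_finite_induct) (auto intro: poly_fun_const poly_fun_mult)

lemma poly_fun_power: "f \<in> poly_fun V \<Longrightarrow> (\<lambda>x. f x ^ k) \<in> poly_fun V"
  by (induction k) (auto intro: poly_fun_const poly_fun_mult)

lemma poly_fun_cong:
  assumes "f \<in> poly_fun V" "\<And>v. v \<in> V \<Longrightarrow> x v = y v"
  shows "f x = f y"
  using assms by induction auto

text \<open>\<open>n\<close> is a strict degree bound, uniform in \<open>x\<close>. The true degree
  drops where coefficients vanish, so elimination counts with \<open>n\<close>; bound 0 forces the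
  zero polynomial.\<close>

definition poly_family :: "'v set \<Rightarrow> nat \<Rightarrow> (('v \<Rightarrow> 'a::comm_ring_1) \<Rightarrow> 'a poly) set" where
  "poly_family V n = {P. (\<forall>k. (\<lambda>x. coeff (P x) k) \<in> poly_fun V) \<and> (\<forall>x. \<forall>k\<ge>n. coeff (P x) k = 0)}"

lemma poly_familyI:
  "(\<And>k. (\<lambda>x. coeff (P x) k) \<in> poly_fun V) \<Longrightarrow> (\<And>x k. k \<ge> n \<Longrightarrow> coeff (P x) k = 0) \<Longrightarrow> P \<in> poly_family V n"
  by (auto simp: poly_family_def)

lemma poly_family_coeff: "P \<in> poly_family V n \<Longrightarrow> (\<lambda>x. coeff (P x) k) \<in> poly_fun V"
  by (auto simp: poly_family_def)

lemma poly_family_coeff_0: "P \<in> poly_family V n \<Longrightarrow> k \<ge> n \<Longrightarrow> coeff (P x) k = 0"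
  by (auto simp: poly_family_def)

lemma poly_family_mono: "P \<in> poly_family V n \<Longrightarrow> n \<le> m \<Longrightarrow> P \<in> poly_family V m"
  by (auto simp: poly_family_def)

lemma poly_family_add: "P \<in> poly_family V n \<Longrightarrow> Q \<in> poly_family V m \<Longrightarrow> (\<lambda>x. P x + Q x) \<in> poly_family V (max n m)"
  by (auto simp: poly_family_def intro: poly_fun_add)

lemma poly_family_mult:
  assumes "P \<in> poly_family V n" "Q \<in> poly_family V m"
  shows "(\<lambda>x. P x * Q x) \<in> poly_family V (n + m)"
proof (rule poly_familyI)
  show "(\<lambda>x. coeff (P x * Q x) k) \<in> poly_fun V" for k
    unfolding coeff_mult using assms by (intro poly_fun_sum poly_fun_mult poly_family_coeff)
  show "coeff (P x * Q x) k = 0" if "k \<ge> n + m" for x k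
    unfolding coeff_mult
  proof (rule sum.neutral, rule ballI)
    fix i assume "i \<in> {..k}"
    then have "i \<ge> n \<or> k - i \<ge> m" using that by auto
    then show "coeff (P x) i * coeff (Q x) (k - i) = 0"
      using assms poly_family_coeff_0 by fastforce
  qed
qed

lemma poly_family_const: "f \<in> poly_fun V \<Longrightarrow> (\<lambda>x. [:f x:]) \<in> poly_family V 1"
proof (rule poly_familyI)
  fix k assume "f \<in> poly_fun V"
  then show "(\<lambda>x. coeff [:f x:] k) \<in> poly_fun V"
    by (cases k) (auto intro: poly_fun_const)
next
  fix x k show "1 \<le> k \<Longrightarrow> coeff [:f x:] k = 0"
    by (cases k) auto
qed

lemma poly_family_power: "P \<in> poly_family V n \<Longrightarrow> \<exists>m. (\<lambda>x. P x ^ k) \<in> poly_family V m"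
proof (induction k)
  case 0
  then show ?case using poly_family_const[OF poly_fun_const[of 1]] by (auto simp: one_pCons)
next
  case (Suc k)
  then show ?case using poly_family_mult by fastforce
qed

text \<open>Common source of \<open>poly_fun_expand\<close>, which singles out one coordinate, and
  \<open>poly_fun_line\<close>, which restricts to a line whose direction varies: by induction it
  suffices to look at the substituted coordinates.\<close>

lemma poly_fun_subst:
  assumes "f \<in> poly_fun W"
    and T: "\<And>v. v \<in> W \<Longrightarrow> \<exists>n P. P \<in> poly_family V n \<and> (\<forall>x y. T x y v = poly (P x) y)"
  shows "\<exists>n P. P \<in> poly_family V n \<and> (\<forall>x y. f (T x y) = poly (P x) y)"
  using assms(1)
proof induction
  case (poly_fun_const c)
  then show ?case
    using poly_family_const[OF poly_fun.poly_fun_const[of c V]]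
    by (intro exI[of _ 1] exI[of _ "\<lambda>x. [:c:]"]) auto
next
  case (poly_fun_var v)
  then show ?case using T by blast
next
  case (poly_fun_add f g)
  then obtain n P m Q where "P \<in> poly_family V n" "\<forall>x y. f (T x y) = poly (P x) y"
    "Q \<in> poly_family V m" "\<forall>x y. g (T x y) = poly (Q x) y" by blast
  then show ?case
    by (intro exI[of _ "max n m"] exI[of _ "\<lambda>x. P x + Q x"]) (auto intro: poly_family_add)
next
  case (poly_fun_mult f g)
  then obtain n P m Q where "P \<in> poly_family V n" "\<forall>x y. f (T x y) = poly (P x) y"
    "Q \<in> poly_family V m" "\<forall>x y. g (T x y) = poly (Q x) y" by blast
  then show ?case
    by (intro exI[of _ "n + m"] exI[of _ "\<lambda>x. P x * Q x"]) (auto intro: poly_family_mult)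
qed

lemma poly_family_var: "(\<lambda>x. [:0, 1:]) \<in> poly_family V 2"
proof (rule poly_familyI)
  fix k show "(\<lambda>x. coeff [:0, 1:] k) \<in> poly_fun V"
    by (rule poly_fun_const)
next
  fix x :: "'a \<Rightarrow> 'b" and k :: nat
  assume "2 \<le> k" then show "coeff [:0, 1::'b:] k = 0"
    by (cases k; cases "k - 1") auto
qed

lemma poly_fun_expand:
  assumes "f \<in> poly_fun (insert v V)"
  shows "\<exists>n P. P \<in> poly_family V n \<and> (\<forall>x y. f (x(v := y)) = poly (P x) y)"
proof (rule poly_fun_subst[OF assms])
  fix w assume w: "w \<in> insert v V"
  show "\<exists>n P. P \<in> poly_family V n \<and> (\<forall>x y. (x(v := y)) w = poly (P x) y)"
  proof (cases "w = v")
    case True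
    then show ?thesis
      by (intro exI[of _ 2] exI[of _ "\<lambda>x. [:0, 1:]"]) (auto intro: poly_family_var)
  next
    case False
    then show ?thesis using w
      by (intro exI[of _ 1] exI[of _ "\<lambda>x. [:x w:]"]) (auto intro: poly_family_const[simplified] poly_fun_var)
  qed
qed

lemma poly_fun_line:
  assumes "f \<in> poly_fun V"
  shows "\<exists>n P. P \<in> poly_family V n \<and> (\<forall>x t. f (\<lambda>v. a v + t * x v) = poly (P x) t)"
proof (rule poly_fun_subst[OF assms])
  fix v assume v: "v \<in> V"
  have "(\<lambda>x. [:a v:] + [:x v:] * [:0, 1:]) \<in> poly_family V (max 1 (1 + 2))"
    by (intro poly_family_add poly_family_mult poly_family_const poly_family_var poly_fun_const poly_fun_var v)
  then show "\<exists>n P. P \<in> poly_family V n \<and> (\<forall>x y. a v + y * x v = poly (P x) y)"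
    by (intro exI[of _ "max 1 (1+2)"] exI[of _ "\<lambda>x. [:a v:] + [:x v:] * [:0, 1:]"])
      (auto simp: algebra_simps)
qed

text \<open>Irreducibility of affine space. On the line joining \<open>a\<close> and
  \<open>b\<close> both functions become nonzero univariate polynomials, and an infinite domain has
  a parameter that is a root of neither.\<close>

lemma poly_fun_mult_nonzero:
  fixes f g :: "('v \<Rightarrow> 'a::{idom, ring_char_0}) \<Rightarrow> 'a"
  assumes "f \<in> poly_fun V" "g \<in> poly_fun V" "f a \<noteq> 0" "g b \<noteq> 0"
  shows "\<exists>x. f x \<noteq> 0 \<and> g x \<noteq> 0"
proof -
  obtain P where P: "\<And>t x. f (\<lambda>v. a v + t * x v) = poly (P x) t"
    using poly_fun_line[OF assms(1), of a] by blast
  obtain Q where Q: "\<And>t x. g (\<lambda>v. a v + t * x v) = poly (Q x) t"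
    using poly_fun_line[OF assms(2), of a] by blast
  define x where "x = (\<lambda>v. b v - a v)"
  have "poly (P x) 0 \<noteq> 0" using P[of 0 x] assms(3) by simp
  moreover have "poly (Q x) 1 \<noteq> 0" using Q[of 1 x] assms(4) by (simp add: x_def)
  ultimately have "P x * Q x \<noteq> 0" by auto
  then have "finite {t. poly (P x * Q x) t = 0}" by (rule poly_roots_finite)
  then obtain t where "poly (P x * Q x) t \<noteq> 0"
    using ex_new_if_finite[OF infinite_UNIV_char_0] by blast
  then show ?thesis using P[of t x] Q[of t x] by (metis mult_zero_left mult_zero_right poly_mult)
qed

section \<open>Constructible sets as Boolean combinations of polynomial equations\<close>

inductive_set constructible :: "'v set \<Rightarrow> (('v \<Rightarrow> 'a::comm_ring_1) \<Rightarrow> bool) set" for V where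
  constructible_eq: "f \<in> poly_fun V \<Longrightarrow> (\<lambda>x. f x = 0) \<in> constructible V"
| constructible_not: "A \<in> constructible V \<Longrightarrow> (\<lambda>x. \<not> A x) \<in> constructible V"
| constructible_conj: "A \<in> constructible V \<Longrightarrow> B \<in> constructible V \<Longrightarrow> (\<lambda>x. A x \<and> B x) \<in> constructible V"

lemma constructible_disj: "A \<in> constructible V \<Longrightarrow> B \<in> constructible V \<Longrightarrow> (\<lambda>x. A x \<or> B x) \<in> constructible V"
  using constructible_not[OF constructible_conj[OF constructible_not[of A V] constructible_not[of B V]]] by simp

lemma constructible_True: "(\<lambda>x. True) \<in> constructible V"
  using constructible_eq[OF poly_fun_const[of 0 V]] by simp

lemma constructible_ball:
  "finite I \<Longrightarrow> (\<And>i. i \<in> I \<Longrightarrow> A i \<in> constructible V) \<Longrightarrow> (\<lambda>x. \<forall>i\<in>I. A i x) \<in> constructible V"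
  by (induction I rule: finite_induct) (auto intro: constructible_True constructible_conj)

lemma constructible_bex:
  "finite I \<Longrightarrow> (\<And>i. i \<in> I \<Longrightarrow> A i \<in> constructible V) \<Longrightarrow> (\<lambda>x. \<exists>i\<in>I. A i x) \<in> constructible V"
  using constructible_not[OF constructible_ball[of I "\<lambda>i x. \<not> A i x" V]] by (simp add: constructible_not)

text \<open>The symmetric form makes negation trivial. For a conjunction the product of the two
  witnesses works, and it is not identically zero by \<open>poly_fun_mult_nonzero\<close>. To obtain
  an open set inside a constructible set it is then enough to refute the second alternative.\<close>

lemma constructible_dichotomy:
  fixes A :: "('v \<Rightarrow> 'a::{idom, ring_char_0}) \<Rightarrow> bool"
  assumes "A \<in> constructible V"
  shows "\<exists>g\<in>poly_fun V. (\<exists>x. g x \<noteq> 0) \<and> ((\<forall>x. g x \<noteq> 0 \<longrightarrow> A x) \<or> (\<forall>x. g x \<noteq> 0 \<longrightarrow> \<not> A x))"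
  using assms
proof induction
  case (constructible_eq f)
  show ?case
  proof (cases "\<exists>x. f x \<noteq> 0")
    case True
    then show ?thesis using constructible_eq by blast
  next
    case False
    then show ?thesis by (intro bexI[of _ "\<lambda>x. 1"]) (auto intro: poly_fun_const)
  qed
next
  case (constructible_not A)
  then show ?case by blast
next
  case (constructible_conj A B)
  then obtain f g where f: "f \<in> poly_fun V" "\<exists>x. f x \<noteq> 0"
      "(\<forall>x. f x \<noteq> 0 \<longrightarrow> A x) \<or> (\<forall>x. f x \<noteq> 0 \<longrightarrow> \<not> A x)"
    and g: "g \<in> poly_fun V" "\<exists>x. g x \<noteq> 0"
      "(\<forall>x. g x \<noteq> 0 \<longrightarrow> B x) \<or> (\<forall>x. g x \<noteq> 0 \<longrightarrow> \<not> B x)"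
    by blast
  have "\<exists>x. f x * g x \<noteq> 0" using poly_fun_mult_nonzero f g by fastforce
  then show ?case
    using f(3) g(3) by (intro bexI[of _ "\<lambda>x. f x * g x"] poly_fun_mult f g) auto
qed

text \<open>The formal leading coefficient of a member of \<open>poly_family V n\<close> is its coefficient at \<open>n - 1\<close>.\<close>

lemma poly_family_drop_lead:
  assumes "P \<in> poly_family V n"
  shows "(\<lambda>x. P x - monom (coeff (P x) (n - 1)) (n - 1)) \<in> poly_family V (n - 1)"
proof (rule poly_familyI)
  show "(\<lambda>x. coeff (P x - monom (coeff (P x) (n - 1)) (n - 1)) k) \<in> poly_fun V" for k
    using poly_family_coeff[OF assms] by (cases "k = n - 1") (auto intro: poly_fun_const)
  show "n - 1 \<le> k \<Longrightarrow> coeff (P x - monom (coeff (P x) (n - 1)) (n - 1)) k = 0" for x k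
    using poly_family_coeff_0[OF assms, of k x] by (cases "k = n - 1") auto
qed

text \<open>The two products have the same coefficient at \<open>n - 1\<close>, so it cancels.
  Cross-multiplying by formal leading coefficients, instead of dividing, keeps all coefficients
  polynomial in \<open>x\<close>.\<close>

lemma poly_family_pseudo_step:
  assumes P: "P \<in> poly_family V n" and Q: "Q \<in> poly_family V m" and nm: "m \<le> n" "m > 0"
  shows "(\<lambda>x. smult (coeff (Q x) (m - 1)) (P x) -
           smult (coeff (P x) (n - 1)) (monom 1 (n - m) * Q x)) \<in> poly_family V (n - 1)"
proof (rule poly_familyI)
  show "(\<lambda>x. coeff (smult (coeff (Q x) (m - 1)) (P x) -
           smult (coeff (P x) (n - 1)) (monom 1 (n - m) * Q x)) k) \<in> poly_fun V" for k
    using poly_family_coeff[OF P] poly_family_coeff[OF Q]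
    by (cases "k < n - m") (auto simp: coeff_monom_mult intro!: poly_fun_diff poly_fun_mult)
  show "coeff (smult (coeff (Q x) (m - 1)) (P x) -
           smult (coeff (P x) (n - 1)) (monom 1 (n - m) * Q x)) k = 0" if "n - 1 \<le> k" for x k
  proof (cases "k = n - 1")
    case True
    then show ?thesis using nm by (auto simp: coeff_monom_mult)
  next
    case False
    then have "k \<ge> n" using that by auto
    then show ?thesis
      using nm poly_family_coeff_0[OF P, of k x] poly_family_coeff_0[OF Q, of "k - (n - m)" x]
      by (auto simp: coeff_monom_mult)
  qed
qed

text \<open>Iterated pseudo-division. The exponent \<open>e\<close> does not depend on
  \<open>x\<close>, so a single family \<open>R\<close> serves for all \<open>x\<close>. The
  quotient enters only through divisibility at each fixed \<open>x\<close> and is therefore a bare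
  function.\<close>

lemma poly_family_pseudo_rem:
  assumes P: "P \<in> poly_family V n" "n > 0" and G: "G \<in> poly_family V N"
  shows "\<exists>R e Q. R \<in> poly_family V (n - 1) \<and>
    (\<forall>x. smult (coeff (P x) (n - 1) ^ e) (G x) = P x * Q x + R x)"
  using G
proof (induction N arbitrary: G)
  case 0
  then show ?case
    by (intro exI[of _ G] exI[of _ 0] exI[of _ "\<lambda>_. 0"]) (auto intro: poly_family_mono)
next
  case (Suc N)
  show ?case
  proof (cases "Suc N \<le> n - 1")
    case True
    then show ?thesis using Suc.prems
      by (intro exI[of _ G] exI[of _ 0] exI[of _ "\<lambda>_. 0"]) (auto intro: poly_family_mono)
  next
    case False
    let ?a = "\<lambda>x. coeff (P x) (n - 1)"
    let ?c = "\<lambda>x. smult (coeff (G x) N) (monom 1 (Suc N - n))"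
    have "(\<lambda>x. smult (?a x) (G x) - smult (coeff (G x) N) (monom 1 (Suc N - n) * P x)) \<in> poly_family V N"
      using poly_family_pseudo_step[OF Suc.prems P(1)] False P(2) by simp
    from Suc.IH[OF this] obtain R e Q where R: "R \<in> poly_family V (n - 1)"
      and eq: "\<And>x. smult (?a x ^ e) (smult (?a x) (G x) - smult (coeff (G x) N) (monom 1 (Suc N - n) * P x))
        = P x * Q x + R x" by blast
    have "smult (?a x ^ Suc e) (G x) = P x * (Q x + smult (?a x ^ e) (?c x)) + R x" for x
      using eq[of x] by (simp add: algebra_simps smult_diff_right)
    then show ?thesis using R
      by (intro exI[of _ R] exI[of _ "Suc e"] exI[of _ "\<lambda>x. Q x + smult (?a x ^ e) (?c x)"]) auto
  qed
qed

section \<open>Elimination and dominance\<close>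

text \<open>Where the formal leading coefficient is nonzero, \<open>P x\<close> has degree exactly
  \<open>n - 1\<close>. By the univariate Nullstellensatz all its roots are roots of
  \<open>H x\<close> iff \<open>P x\<close> divides \<open>H x ^ (n - 1)\<close>. This holds iff the
  pseudo-remainder is 0, since its degree bound leaves no room for a nonzero multiple of
  \<open>P x\<close>; that is a condition on finitely many coefficients.\<close>

lemma poly_family_root_constructible:
  assumes "P \<in> poly_family V n" "H \<in> poly_family V m" "n > 0"
  shows "\<exists>B\<in>constructible V. \<forall>x. coeff (P x) (n - 1) \<noteq> 0 \<longrightarrow>
    (B x \<longleftrightarrow> (\<exists>y::complex. poly (P x) y = 0 \<and> poly (H x) y \<noteq> 0))"
proof -
  obtain N where N: "(\<lambda>x. H x ^ (n - 1)) \<in> poly_family V N"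
    using poly_family_power[OF assms(2)] by blast
  obtain R e Q where R: "R \<in> poly_family V (n - 1)"
    and eq: "\<And>x. smult (coeff (P x) (n - 1) ^ e) (H x ^ (n - 1)) = P x * Q x + R x"
    using poly_family_pseudo_rem[OF assms(1,3) N] by blast
  have B: "(\<lambda>x. \<exists>k\<in>{..<n - 1}. \<not> coeff (R x) k = 0) \<in> constructible V"
    by (intro constructible_bex constructible_not constructible_eq poly_family_coeff[OF R]) simp
  show ?thesis
  proof (intro bexI[OF _ B] allI impI)
    fix x assume lead: "coeff (P x) (n - 1) \<noteq> 0"
    have "degree (P x) \<le> n - 1"
      using poly_family_coeff_0[OF assms(1)] by (intro degree_le) auto
    then have deg: "degree (P x) = n - 1" using lead le_degree by (metis antisym)
    have "P x \<noteq> 0" using lead by auto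
    have "(\<nexists>y. poly (P x) y = 0 \<and> poly (H x) y \<noteq> 0) \<longleftrightarrow> P x dvd H x ^ (n - 1)"
      using nullstellensatz_univariate[of "P x" "H x"] \<open>P x \<noteq> 0\<close> deg by auto
    also have "\<dots> \<longleftrightarrow> P x dvd smult (coeff (P x) (n - 1) ^ e) (H x ^ (n - 1))"
      using lead by (simp add: dvd_smult_iff)
    also have "\<dots> \<longleftrightarrow> P x dvd R x"
      unfolding eq by (simp add: dvd_add_right_iff)
    also have "\<dots> \<longleftrightarrow> R x = 0"
    proof
      assume dvd: "P x dvd R x"
      show "R x = 0"
      proof (rule ccontr)
        assume "R x \<noteq> 0"
        then have "degree (R x) \<ge> n - 1" using dvd deg dvd_imp_degree_le by metis
        then have "lead_coeff (R x) = 0" by (intro poly_family_coeff_0[OF R])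
        then show False using \<open>R x \<noteq> 0\<close> by simp
      qed
    qed auto
    also have "\<dots> \<longleftrightarrow> (\<forall>k<n - 1. coeff (R x) k = 0)"
    proof
      assume "\<forall>k<n - 1. coeff (R x) k = 0"
      then have "coeff (R x) k = 0" for k
        using poly_family_coeff_0[OF R, of k x] by (cases "k < n - 1") auto
      then show "R x = 0" by (simp add: poly_eq_iff)
    qed auto
    finally show "(\<exists>k\<in>{..<n - 1}. \<not> coeff (R x) k = 0) \<longleftrightarrow>
        (\<exists>y. poly (P x) y = 0 \<and> poly (H x) y \<noteq> 0)" by auto
  qed
qed

lemma constructible_if:
  assumes "f \<in> poly_fun V" "B \<in> constructible V" "C \<in> constructible V"
    and "\<And>x. f x = 0 \<Longrightarrow> A x = B x" "\<And>x. f x \<noteq> 0 \<Longrightarrow> A x = C x"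
  shows "A \<in> constructible V"
proof -
  have "A = (\<lambda>x. (f x = 0 \<and> B x) \<or> (\<not> f x = 0 \<and> C x))"
    using assms(4,5) by blast
  then show ?thesis using assms(1-3) by (auto intro!: constructible_disj constructible_conj constructible_not constructible_eq)
qed

text \<open>Eliminating one variable: case distinctions on leading coefficients and pseudo-division
  reduce the number of equations to at most one.\<close>

lemma constructible_ex_system:
  fixes Fs :: "(nat \<times> (('v \<Rightarrow> complex) \<Rightarrow> complex poly)) list"
  assumes "\<And>n P. (n, P) \<in> set Fs \<Longrightarrow> P \<in> poly_family V n" and H: "H \<in> poly_family V m"
  shows "(\<lambda>x. \<exists>y. (\<forall>(n, P)\<in>set Fs. poly (P x) y = 0) \<and> poly (H x) y \<noteq> 0) \<in> constructible V"
  using assms(1)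
\<comment> \<open>The measure uses the bounds, not the true degrees; the \<open>Suc\<close> makes it
  drop also when an equation with bound 0 is deleted.\<close>
proof (induction "sum_list (map (\<lambda>(n, P). Suc n) Fs)" arbitrary: Fs rule: less_induct)
  case less
  define E where "E = (\<lambda>(Fs :: (nat \<times> (('v \<Rightarrow> complex) \<Rightarrow> complex poly)) list) x.
    \<exists>y. (\<forall>(n, P)\<in>set Fs. poly (P x) y = 0) \<and> poly (H x) y \<noteq> 0)"
  have IH: "E Gs \<in> constructible V"
    if "sum_list (map (\<lambda>(n, P). Suc n) Gs) < sum_list (map (\<lambda>(n, P). Suc n) Fs)"
      "\<And>n P. (n, P) \<in> set Gs \<Longrightarrow> P \<in> poly_family V n" for Gs
    using less.hyps[OF that] by (simp add: E_def)
  have zero: "P x = 0" if "P \<in> poly_family V 0" for P :: "('v \<Rightarrow> complex) \<Rightarrow> complex poly" and x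
    using poly_family_coeff_0[OF that] by (auto simp: poly_eq_iff)
  have zero_hd: "E Fs \<in> constructible V" if Fs: "Fs = (0, P) # rest" for P rest
  proof -
    have "P x = 0" for x using zero[of P] less.prems[of 0 P] Fs by simp
    then have "E Fs = E rest" using Fs by (simp add: E_def)
    also have "\<dots> \<in> constructible V" by (rule IH) (use Fs less.prems in auto)
    finally show ?thesis .
  qed
  have zero_snd: "E Fs \<in> constructible V" if Fs: "Fs = q # (0, P) # rest" for q P rest
  proof -
    have "P x = 0" for x using zero[of P] less.prems[of 0 P] Fs by simp
    then have "E Fs = E (q # rest)" using Fs by (simp add: E_def)
    also have "\<dots> \<in> constructible V" by (rule IH) (use Fs less.prems in auto)
    finally show ?thesis .
  qed
  have step: "E ((n, P) # (k, Q) # rest) \<in> constructible V"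
    if P: "P \<in> poly_family V n" and Q: "Q \<in> poly_family V k" and nk: "k \<le> n" "k > 0"
      and rest: "\<And>n P. (n, P) \<in> set rest \<Longrightarrow> P \<in> poly_family V n"
      and len: "Suc n + (Suc k + sum_list (map (\<lambda>(n, P). Suc n) rest)) =
        sum_list (map (\<lambda>(n, P). Suc n) Fs)"
    for n P k Q rest
  proof -
    let ?a = "\<lambda>x. coeff (Q x) (k - 1)"
    let ?Q = "\<lambda>x. Q x - monom (coeff (Q x) (k - 1)) (k - 1)"
    let ?P = "\<lambda>x. smult (?a x) (P x) - smult (coeff (P x) (n - 1)) (monom 1 (n - k) * Q x)"
    \<comment> \<open>If the formal leading coefficient of \<open>Q\<close> vanishes,
      \<open>Q\<close> may be truncated. Otherwise it is invertible, and replacing \<open>P\<close>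
      by the pseudo-division step keeps the common roots. Both systems have smaller measure.\<close>
    have "E ((n, P) # (k - 1, ?Q) # rest) \<in> constructible V"
      by (rule IH) (use len nk rest P poly_family_drop_lead[OF Q] in auto)
    moreover have "E ((n - 1, ?P) # (k, Q) # rest) \<in> constructible V"
      by (rule IH) (use len nk rest Q poly_family_pseudo_step[OF P Q nk] in auto)
    ultimately show ?thesis
    proof (rule constructible_if[OF poly_family_coeff[OF Q]])
      show "E ((n, P) # (k, Q) # rest) x = E ((n, P) # (k - 1, ?Q) # rest) x" if "?a x = 0" for x
        using that by (simp add: E_def)
      show "E ((n, P) # (k, Q) # rest) x = E ((n - 1, ?P) # (k, Q) # rest) x" if "?a x \<noteq> 0" for x
        proof -
        have "(\<forall>(n, P)\<in>set ((n, P) # (k, Q) # rest). poly (P x) y = 0) \<longleftrightarrow>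
            (\<forall>(n, P)\<in>set ((n - 1, ?P) # (k, Q) # rest). poly (P x) y = 0)" for y
          using that by auto
        then show ?thesis by (simp only: E_def)
      qed
    qed
  qed
  consider "Fs = []" | n P where "Fs = [(n, P)]" "n > 0"
    | n P k Q rest where "Fs = (n, P) # (k, Q) # rest" "n > 0" "k > 0"
    | P rest where "Fs = (0, P) # rest" | P q rest where "Fs = q # (0, P) # rest"
  proof (cases Fs)
    case (Cons q Gs)
    obtain n P where q: "q = (n, P)" by (cases q)
    show ?thesis
    proof (cases Gs)
      case Nil
      then show ?thesis using Cons q that(2,4) by (cases n) auto
    next
      case (Cons r rest)
      obtain k Q where "r = (k, Q)" by (cases r)
      then show ?thesis using Cons q \<open>Fs = q # Gs\<close> that(3,4,5) by (cases n; cases k) auto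
    qed
  qed (rule that(1))
  then have "E Fs \<in> constructible V"
  proof cases
    case 1
    have "E Fs x \<longleftrightarrow> (\<exists>k\<in>{..<m}. \<not> coeff (H x) k = 0)" for x
    proof -
      have "E Fs x \<longleftrightarrow> H x \<noteq> 0" using 1 poly_all_0_iff_0[of "H x"] by (auto simp: E_def)
      also have "\<dots> \<longleftrightarrow> (\<exists>k\<in>{..<m}. \<not> coeff (H x) k = 0)"
        using poly_family_coeff_0[OF H, of _ x] by (metis coeff_0 lessThan_iff linorder_not_le poly_eq_iff)
      finally show ?thesis .
    qed
    then have "E Fs = (\<lambda>x. \<exists>k\<in>{..<m}. \<not> coeff (H x) k = 0)" by (rule ext)
    also have "\<dots> \<in> constructible V"
      by (intro constructible_bex constructible_not constructible_eq poly_family_coeff[OF H]) simp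
    finally show ?thesis .
  next
    case 2
    then have P: "P \<in> poly_family V n" using less.prems by auto
    obtain B where B: "B \<in> constructible V" "\<And>x. coeff (P x) (n - 1) \<noteq> 0 \<Longrightarrow>
        B x = (\<exists>y. poly (P x) y = 0 \<and> poly (H x) y \<noteq> 0)"
      using poly_family_root_constructible[OF P H] 2 by blast
    have "E [(n - 1, \<lambda>x. P x - monom (coeff (P x) (n - 1)) (n - 1))] \<in> constructible V"
      by (rule IH) (use 2 poly_family_drop_lead[OF P] in auto)
    then show ?thesis
      by (rule constructible_if[OF poly_family_coeff[OF P, of "n - 1"] _ B(1)])
        (use B(2) 2 in \<open>auto simp: E_def\<close>)
  next
    case 3
    have PQ: "P \<in> poly_family V n" "Q \<in> poly_family V k" "\<And>n P. (n, P) \<in> set rest \<Longrightarrow> P \<in> poly_family V n"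
      using 3 less.prems by auto
    show ?thesis
    proof (cases "k \<le> n")
      case True
      then show ?thesis using step[OF PQ(1,2) True 3(3) PQ(3)] 3 by simp
    next
      case False
      have "E Fs = E ((k, Q) # (n, P) # rest)" using 3 by (auto simp: E_def)
      also have "\<dots> \<in> constructible V" using step[OF PQ(2,1) _ 3(2) PQ(3)] 3 False by simp
      finally show ?thesis .
    qed
  qed (rule zero_hd zero_snd, assumption)+
  then show ?case by (simp add: E_def)
qed

lemma constructible_basic_ex:
  fixes F :: "(('v \<Rightarrow> complex) \<Rightarrow> complex) list"
  assumes "set F \<subseteq> poly_fun (insert v V)" "h \<in> poly_fun (insert v V)"
  shows "(\<lambda>x. \<exists>y. (\<forall>f\<in>set F. f (x(v := y)) = 0) \<and> h (x(v := y)) \<noteq> 0) \<in> constructible V"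
proof -
  define ex where "ex f n P \<longleftrightarrow> P \<in> poly_family V n \<and> (\<forall>x y. f (x(v := y)) = poly (P x) y)"
    for f :: "('v \<Rightarrow> complex) \<Rightarrow> complex" and n P
  obtain m H where H: "ex h m H"
    using poly_fun_expand[OF assms(2)] by (auto simp: ex_def)
  have "\<forall>f\<in>set F. \<exists>q. ex f (fst q) (snd q)"
    using poly_fun_expand assms(1) by (fastforce simp: ex_def)
  then obtain q where q: "\<And>f. f \<in> set F \<Longrightarrow> ex f (fst (q f)) (snd (q f))" by metis
  have "(\<lambda>x. \<exists>y. (\<forall>(n, P)\<in>set (map q F). poly (P x) y = 0) \<and> poly (H x) y \<noteq> 0) \<in> constructible V"
  proof (rule constructible_ex_system)
    show "P \<in> poly_family V n" if "(n, P) \<in> set (map q F)" for n P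
      using that q by (auto simp: ex_def image_iff) (metis fst_conv snd_conv)
    show "H \<in> poly_family V m" using H by (simp add: ex_def)
  qed
  moreover have "(\<forall>(n, P)\<in>set (map q F). poly (P x) y = 0) \<longleftrightarrow>
      (\<forall>f\<in>set F. f (x(v := y)) = 0)" for x y
    using q by (auto simp: ex_def split_beta)
  moreover have "poly (H x) y = h (x(v := y))" for x y using H by (simp add: ex_def)
  ultimately show ?thesis by simp
qed

text \<open>The existential quantifier commutes with the outer disjunction, and one inequation per
  clause suffices because inequations can be multiplied; each clause then has the shape of
  \<open>constructible_basic_ex\<close>.\<close>

lemma constructible_dnf:
  fixes A :: "('v \<Rightarrow> complex) \<Rightarrow> bool"
  assumes "A \<in> constructible V"
  shows "\<exists>D. (\<forall>(F, h)\<in>set D. set F \<subseteq> poly_fun V \<and> h \<in> poly_fun V) \<and>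
    (\<forall>x. A x \<longleftrightarrow> (\<exists>(F, h)\<in>set D. (\<forall>f\<in>set F. f x = 0) \<and> h x \<noteq> 0))" (is "?dnf A")
proof -
  have conj: "?dnf (\<lambda>x. A x \<and> B x)" if A: "?dnf A" and B: "?dnf B" for A B
  proof -
    obtain D where D: "\<forall>(F, h)\<in>set D. set F \<subseteq> poly_fun V \<and> h \<in> poly_fun V"
      "\<forall>x. A x \<longleftrightarrow> (\<exists>(F, h)\<in>set D. (\<forall>f\<in>set F. f x = 0) \<and> h x \<noteq> 0)"
      using A by (elim exE conjE)
    obtain D' where D': "\<forall>(F, h)\<in>set D'. set F \<subseteq> poly_fun V \<and> h \<in> poly_fun V"
      "\<forall>x. B x \<longleftrightarrow> (\<exists>(F, h)\<in>set D'. (\<forall>f\<in>set F. f x = 0) \<and> h x \<noteq> 0)"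
      using B by (elim exE conjE)
    define comb :: "((('v \<Rightarrow> complex) \<Rightarrow> complex) list \<times> (('v \<Rightarrow> complex) \<Rightarrow> complex)) \<Rightarrow> _ \<Rightarrow> _"
      where "comb c c' = (fst c @ fst c', \<lambda>x. snd c x * snd c' x)" for c c'
    define D'' where "D'' = map (\<lambda>(c, c'). comb c c') (List.product D D')"
    have set: "set D'' = (\<Union>c\<in>set D. \<Union>c'\<in>set D'. {comb c c'})"
      unfolding D''_def by auto
    have "\<forall>(F, h)\<in>set D''. set F \<subseteq> poly_fun V \<and> h \<in> poly_fun V"
      unfolding set comb_def using D(1) D'(1) by (fastforce intro: poly_fun_mult)
    moreover have "(A x \<and> B x) \<longleftrightarrow> (\<exists>(F, h)\<in>set D''. (\<forall>f\<in>set F. f x = 0) \<and> h x \<noteq> 0)" for x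
      unfolding D(2)[rule_format] D'(2)[rule_format] set comb_def
      by (simp add: split_beta ball_Un) blast
    ultimately show ?thesis by blast
  qed
  have disj: "?dnf (\<lambda>x. A x \<or> B x)" if A: "?dnf A" and B: "?dnf B" for A B
  proof -
    obtain D where D: "\<forall>(F, h)\<in>set D. set F \<subseteq> poly_fun V \<and> h \<in> poly_fun V"
      "\<forall>x. A x \<longleftrightarrow> (\<exists>(F, h)\<in>set D. (\<forall>f\<in>set F. f x = 0) \<and> h x \<noteq> 0)"
      using A by (elim exE conjE)
    obtain D' where D': "\<forall>(F, h)\<in>set D'. set F \<subseteq> poly_fun V \<and> h \<in> poly_fun V"
      "\<forall>x. B x \<longleftrightarrow> (\<exists>(F, h)\<in>set D'. (\<forall>f\<in>set F. f x = 0) \<and> h x \<noteq> 0)"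
      using B by (elim exE conjE)
    show ?thesis by (rule exI[of _ "D @ D'"]) (use D D' in auto)
  qed
  \<comment> \<open>Carrying \<open>A\<close> and its negation through the induction together makes
    the negation case a mere swap.\<close>
  have "?dnf A \<and> ?dnf (\<lambda>x. \<not> A x)"
    using assms
  proof induction
    case (constructible_eq f)
    have "?dnf (\<lambda>x. f x = 0)"
      by (rule exI[of _ "[([f], \<lambda>x. 1)]"]) (use constructible_eq poly_fun_const in auto)
    moreover have "?dnf (\<lambda>x. \<not> f x = 0)"
      by (rule exI[of _ "[([], f)]"]) (use constructible_eq in auto)
    ultimately show ?case ..
  next
    case (constructible_not A)
    then show ?case by simp
  next
    case (constructible_conj A B)
    have "?dnf (\<lambda>x. \<not> A x \<or> \<not> B x)" using constructible_conj by (intro disj) auto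
    then show ?case using constructible_conj by (auto intro!: conj)
  qed
  then show ?thesis ..
qed

lemma constructible_ex:
  fixes A :: "('v \<Rightarrow> complex) \<Rightarrow> bool"
  assumes "A \<in> constructible (insert v V)"
  shows "(\<lambda>x. \<exists>y. A (x(v := y))) \<in> constructible V"
proof -
  obtain D where D: "\<forall>(F, h)\<in>set D. set F \<subseteq> poly_fun (insert v V) \<and> h \<in> poly_fun (insert v V)"
    "\<forall>x. A x \<longleftrightarrow> (\<exists>(F, h)\<in>set D. (\<forall>f\<in>set F. f x = 0) \<and> h x \<noteq> 0)"
    using constructible_dnf[OF assms] by (elim exE conjE)
  have "(\<lambda>x. \<exists>c\<in>set D. \<exists>y. (\<forall>f\<in>set (fst c). f (x(v := y)) = 0) \<and> snd c (x(v := y)) \<noteq> 0) \<in> constructible V"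
    using D(1) by (intro constructible_bex constructible_basic_ex) (auto simp: split_beta)
  moreover have "(\<exists>y. A (x(v := y))) \<longleftrightarrow> (\<exists>c\<in>set D. \<exists>y. (\<forall>f\<in>set (fst c). f (x(v := y)) = 0) \<and> snd c (x(v := y)) \<noteq> 0)" for x
    unfolding D(2)[rule_format] by (auto simp: split_beta)
  ultimately show ?thesis by simp
qed

lemma constructible_ex_finite:
  fixes A :: "('v \<Rightarrow> complex) \<Rightarrow> bool"
  assumes "finite U" "A \<in> constructible (U \<union> V)"
  shows "(\<lambda>x. \<exists>z. A (\<lambda>v. if v \<in> U then z v else x v)) \<in> constructible V"
  using assms
proof (induction U arbitrary: A rule: finite_induct)
  case (insert u U)
  have "(\<lambda>x. \<exists>y. A (x(u := y))) \<in> constructible (U \<union> V)"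
    using insert.prems by (intro constructible_ex) auto
  from insert.IH[OF this]
  have "(\<lambda>x. \<exists>z y. A ((\<lambda>v. if v \<in> U then z v else x v)(u := y))) \<in> constructible V" .
  moreover have "(\<exists>z y. A ((\<lambda>v. if v \<in> U then z v else x v)(u := y))) \<longleftrightarrow>
    (\<exists>z. A (\<lambda>v. if v \<in> insert u U then z v else x v))" (is "?L \<longleftrightarrow> ?R") for x
  proof
    assume ?L
    then obtain z y where "A ((\<lambda>v. if v \<in> U then z v else x v)(u := y))" by blast
    also have "((\<lambda>v. if v \<in> U then z v else x v)(u := y)) =
        (\<lambda>v. if v \<in> insert u U then (z(u := y)) v else x v)" by auto
    finally show ?R by blast
  next
    assume ?R
    then obtain z where "A (\<lambda>v. if v \<in> insert u U then z v else x v)" by blast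
    also have "(\<lambda>v. if v \<in> insert u U then z v else x v) =
        ((\<lambda>v. if v \<in> U then z v else x v)(u := z u))" by auto
    finally show ?L by blast
  qed
  ultimately show ?case by simp
qed simp

section \<open>Dominance along curves, and density of real points\<close>

lemma poly_fun_tendsto:
  fixes f :: "('v \<Rightarrow> 'a::{real_normed_field}) \<Rightarrow> 'a"
  assumes "f \<in> poly_fun V" "\<And>v. v \<in> V \<Longrightarrow> ((\<lambda>m. z m v) \<longlongrightarrow> x v) F"
  shows "((\<lambda>m. f (z m)) \<longlongrightarrow> f x) F"
  using assms by induction (auto intro: tendsto_intros)

text \<open>Expanding \<open>g\<close> along \<open>t \<mapsto> a + t x\<close>, the lowest nonvanishing coefficient is a polynomial
  function of the direction \<open>x\<close>; it would have to vanish in every direction.\<close>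

lemma poly_fun_not_vanish:
  fixes g :: "('v \<Rightarrow> complex) \<Rightarrow> complex"
  assumes g: "g \<in> poly_fun V" "g b \<noteq> 0"
    and S: "\<And>Z. \<exists>z. (\<forall>v\<in>V. ((\<lambda>e. z e v) \<longlongrightarrow> Z v) (at 0)) \<and>
      (\<forall>\<^sub>F e in at 0. (\<lambda>v. a v + e * z e v) \<in> S)"
  shows "\<exists>x\<in>S. g x \<noteq> 0"
proof (rule ccontr)
  assume contra: "\<not> (\<exists>x\<in>S. g x \<noteq> 0)"
  obtain n P where P: "P \<in> poly_family V n" and gP: "\<And>x t. g (\<lambda>v. a v + t * x v) = poly (P x) t"
    using poly_fun_line[OF g(1), of a] by blast
  have "poly (P (\<lambda>v. b v - a v)) 1 \<noteq> 0" using gP[of 1 "\<lambda>v. b v - a v"] g(2) by simp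
  then have "P (\<lambda>v. b v - a v) \<noteq> 0" by auto
  then have ex: "\<exists>s x. coeff (P x) s \<noteq> 0" by (metis leading_coeff_0_iff)
  define s where "s = (LEAST s. \<exists>x. coeff (P x) s \<noteq> 0)"
  obtain Z where Z: "coeff (P Z) s \<noteq> 0"
    using LeastI_ex[OF ex] by (auto simp: s_def)
  have low: "coeff (P x) k = 0" if "k < s" for x k
    using not_less_Least[of k "\<lambda>s. \<exists>x. coeff (P x) s \<noteq> 0"] that by (auto simp: s_def)
  obtain z where z: "\<And>v. v \<in> V \<Longrightarrow> ((\<lambda>e. z e v) \<longlongrightarrow> Z v) (at 0)"
    and zS: "\<forall>\<^sub>F e in at 0. (\<lambda>v. a v + e * z e v) \<in> S" using S[of Z] by blast
  \<comment> \<open>\<open>?h e\<close> is the value of \<open>g\<close> on the path divided by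
    \<open>e ^ s\<close>. If \<open>g\<close> vanished on \<open>S\<close>, it would be 0 near 0,
    yet its limit is the nonzero coefficient at \<open>Z\<close>.\<close>
  let ?h = "\<lambda>e. \<Sum>k<n. coeff (P (z e)) (s + k) * e ^ k"
  have eq: "poly (P x) t = t ^ s * (\<Sum>k<n. coeff (P x) (s + k) * t ^ k)" for x t
  proof -
    have "degree (P x) < s + n \<or> P x = 0"
      using poly_family_coeff_0[OF P, of "degree (P x)" x] by (metis leading_coeff_0_iff not_le_imp_less trans_less_add2)
    then have "poly (P x) t = (\<Sum>k<s + n. coeff (P x) k * t ^ k)"
    proof
      assume "degree (P x) < s + n"
      then show ?thesis unfolding poly_altdef
        by (intro sum.mono_neutral_left) (auto simp: coeff_eq_0)
    qed auto
    also have "\<dots> = (\<Sum>k\<in>{s..<s + n}. coeff (P x) k * t ^ k)"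
      by (intro sum.mono_neutral_right) (auto simp: low)
    also have "\<dots> = (\<Sum>k<n. coeff (P x) (s + k) * t ^ (s + k))"
      by (rule sum.reindex_bij_witness[of _ "\<lambda>k. s + k" "\<lambda>k. k - s"]) auto
    also have "\<dots> = t ^ s * (\<Sum>k<n. coeff (P x) (s + k) * t ^ k)"
      by (simp add: sum_distrib_left power_add algebra_simps)
    finally show ?thesis .
  qed
  have "(?h \<longlongrightarrow> (\<Sum>k<n. coeff (P Z) (s + k) * 0 ^ k)) (at 0)"
    by (intro tendsto_intros poly_fun_tendsto[OF poly_family_coeff[OF P]] z)
  moreover have "(\<Sum>k<n. coeff (P Z) (s + k) * 0 ^ k) = coeff (P Z) s"
  proof -
    have "n > 0" using Z poly_family_coeff_0[OF P, of s Z] by (cases n) auto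
    then obtain n' where "n = Suc n'" by (cases n) auto
    then show ?thesis by (simp add: sum.lessThan_Suc_shift)
  qed
  ultimately have "(?h \<longlongrightarrow> coeff (P Z) s) (at 0)" by simp
  moreover have "\<forall>\<^sub>F e in at 0. ?h e = 0"
    using zS eventually_neq_at_within[of 0 0 UNIV]
  proof eventually_elim
    case (elim e)
    then have "g (\<lambda>v. a v + e * z e v) = 0" using contra by blast
    then show ?case using gP[of e "z e"] eq[of "z e" e] elim by auto
  qed
  ultimately have "((\<lambda>e. 0) \<longlongrightarrow> coeff (P Z) s) (at (0::complex))"
    by (rule Lim_transform_eventually)
  then show False using Z by (simp add: tendsto_const_iff)
qed

text \<open>Write \<open>z\<close> as real part plus \<i> times imaginary part and replace \<i> by a
  variable. The univariate polynomial obtained from \<open>g\<close> is nonzero at \<i>, so some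
  real number is not a root of it.\<close>

lemma poly_fun_real_point:
  fixes g :: "('v \<Rightarrow> complex) \<Rightarrow> complex"
  assumes "g \<in> poly_fun V" "g z \<noteq> 0"
  shows "\<exists>x. g (\<lambda>v. complex_of_real (x v)) \<noteq> 0"
proof -
  define b where "b v = complex_of_real (Im (z v))" for v
  obtain P where P: "\<And>t x. g (\<lambda>v. complex_of_real (Re (z v)) + t * x v) = poly (P x) t"
    using poly_fun_line[OF assms(1), of "\<lambda>v. complex_of_real (Re (z v))"] by blast
  have "z = (\<lambda>v. complex_of_real (Re (z v)) + \<i> * b v)" by (simp add: b_def complex_eq_iff fun_eq_iff)
  then have "poly (P b) \<i> \<noteq> 0" using P[of \<i> b] assms(2) by metis
  then have "P b \<noteq> 0" by auto
  then have "finite {t. poly (P b) t = 0}" by (rule poly_roots_finite)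
  moreover have "infinite (range complex_of_real)"
    using finite_imageD[of complex_of_real UNIV] infinite_UNIV_char_0 inj_of_real by blast
  ultimately have "\<not> range complex_of_real \<subseteq> {t. poly (P b) t = 0}"
    using finite_subset by blast
  then obtain t where "poly (P b) (complex_of_real t) \<noteq> 0" by auto
  then have "g (\<lambda>v. complex_of_real (Re (z v) + t * Im (z v))) \<noteq> 0"
    using P[of "of_real t" b] by (simp add: b_def)
  then show ?thesis by (intro exI[of _ "\<lambda>v. Re (z v) + t * Im (z v)"])
qed

text \<open>Turns the complex condition \<open>g \<noteq> 0\<close> on real games into the condition
  that one of two real polynomial functions is nonzero, as the Zariski topology on games
  requires.\<close>

lemma poly_fun_Re_Im:
  assumes "g \<in> poly_fun V"
  shows "\<exists>p q. p \<in> poly_fun V \<and> q \<in> poly_fun V \<and> (\<forall>x. g (\<lambda>v. complex_of_real (x v)) = Complex (p x) (q x))"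
    (is "\<exists>p q. ?parts g p q")
  using assms
proof induction
  case (poly_fun_const c)
  have "?parts (\<lambda>_. c) (\<lambda>_. Re c) (\<lambda>_. Im c)"
    by (simp add: poly_fun.poly_fun_const)
  then show ?case by (intro exI)
next
  case (poly_fun_var v)
  have "?parts (\<lambda>x. x v) (\<lambda>x. x v) (\<lambda>_. 0)"
    by (simp add: poly_fun.poly_fun_const poly_fun.poly_fun_var poly_fun_var complex_eq_iff)
  then show ?case by (intro exI)
next
  case (poly_fun_add f g)
  then obtain p q p' q' where pq: "?parts f p q" "?parts g p' q'" by (elim exE)
  then have "?parts (\<lambda>x. f x + g x) (\<lambda>x. p x + p' x) (\<lambda>x. q x + q' x)"
    by (intro conjI poly_fun.poly_fun_add) (simp_all add: complex_eq_iff)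
  then show ?case by (intro exI)
next
  case (poly_fun_mult f g)
  then obtain p q p' q' where pq: "?parts f p q" "?parts g p' q'" by (elim exE)
  then have "?parts (\<lambda>x. f x * g x) (\<lambda>x. p x * p' x - q x * q' x) (\<lambda>x. p x * q' x + q x * p' x)"
    by (intro conjI poly_fun.poly_fun_add poly_fun_diff poly_fun.poly_fun_mult) (simp_all add: complex_eq_iff)
  then show ?case by (intro exI)
qed

section \<open>Polynomials and points of projective space\<close>

definition monomial :: "('v \<Rightarrow>\<^sub>0 nat) \<Rightarrow> ('v \<Rightarrow> 'a::comm_ring_1) \<Rightarrow> 'a" where
  "monomial m x = (\<Prod>v\<in>Poly_Mapping.keys m. x v ^ Poly_Mapping.lookup m v)"

lemma monomial_superset:
  "finite W \<Longrightarrow> Poly_Mapping.keys m \<subseteq> W \<Longrightarrow> monomial m x = (\<Prod>v\<in>W. x v ^ Poly_Mapping.lookup m v)"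
  unfolding monomial_def by (rule prod.mono_neutral_left) (auto simp: in_keys_iff)

lemma monomial_add: "monomial (m + m') x = monomial m x * monomial m' x"
  using monomial_superset[of "Poly_Mapping.keys m \<union> Poly_Mapping.keys m'" "m + m'" x]
    monomial_superset[of "Poly_Mapping.keys m \<union> Poly_Mapping.keys m'" m x]
    monomial_superset[of "Poly_Mapping.keys m \<union> Poly_Mapping.keys m'" m' x]
    Poly_Mapping.keys_add[of m m']
  by (simp add: lookup_add power_add prod.distrib)

lemma poly_eval_superset:
  "finite M \<Longrightarrow> Poly_Mapping.keys f \<subseteq> M \<Longrightarrow>
    poly_eval f x = (\<Sum>m\<in>M. Poly_Mapping.lookup f m * monomial m x)"
  unfolding poly_eval_def monomial_def[symmetric]
  by (rule sum.mono_neutral_left) (auto simp: in_keys_iff)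

lemma poly_eval_add: "poly_eval (f + g) x = poly_eval f x + poly_eval g x"
  using poly_eval_superset[of "Poly_Mapping.keys f \<union> Poly_Mapping.keys g" "f + g" x]
    poly_eval_superset[of "Poly_Mapping.keys f \<union> Poly_Mapping.keys g" f x]
    poly_eval_superset[of "Poly_Mapping.keys f \<union> Poly_Mapping.keys g" g x]
    Poly_Mapping.keys_add[of f g]
  by (simp add: lookup_add algebra_simps sum.distrib)

lemma poly_eval_single: "poly_eval (Poly_Mapping.single m c) x = c * monomial m x"
  using poly_eval_superset[of "{m}" "Poly_Mapping.single m c" x] by (simp split: if_splits)

lemma poly_eval_0 [simp]: "poly_eval 0 x = 0"
  by (simp add: poly_eval_def)

lemma poly_eval_sum: "poly_eval (\<Sum>i\<in>I. f i) x = (\<Sum>i\<in>I. poly_eval (f i) x)"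
  by (induction I rule: infinite_finite_induct) (simp_all add: poly_eval_add)

lemma poly_mapping_sum_single:
  "f = (\<Sum>m\<in>Poly_Mapping.keys f. Poly_Mapping.single m (Poly_Mapping.lookup f m))"
  by (rule poly_mapping_eqI) (simp add: lookup_sum lookup_single when_def in_keys_iff)

lemma poly_eval_mult: "poly_eval (f * g) x = poly_eval f x * poly_eval g x"
proof -
  have "f * g = (\<Sum>m\<in>Poly_Mapping.keys f. \<Sum>m'\<in>Poly_Mapping.keys g.
      Poly_Mapping.single (m + m') (Poly_Mapping.lookup f m * Poly_Mapping.lookup g m'))"
    using arg_cong2[OF poly_mapping_sum_single[of f] poly_mapping_sum_single[of g], of "(*)"]
    by (simp only: sum_product mult_single)
  then have "poly_eval (f * g) x = (\<Sum>m\<in>Poly_Mapping.keys f. \<Sum>m'\<in>Poly_Mapping.keys g.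
      (Poly_Mapping.lookup f m * monomial m x) * (Poly_Mapping.lookup g m' * monomial m' x))"
    by (simp add: poly_eval_sum poly_eval_single monomial_add algebra_simps)
  also have "\<dots> = poly_eval f x * poly_eval g x"
    by (simp add: sum_product poly_eval_def monomial_def)
  finally show ?thesis .
qed

text \<open>Together with \<open>poly_fun_poly_eval\<close> this lets the Zariski topology on games
  be handled through functions alone.\<close>

lemma poly_eval_poly_fun:
  assumes "f \<in> polys_in V"
  shows "poly_eval f \<in> poly_fun V"
  unfolding poly_eval_def
proof (intro poly_fun_sum poly_fun_mult poly_fun_const poly_fun_prod poly_fun_power poly_fun_var)
  fix m v assume "m \<in> Poly_Mapping.keys f" "v \<in> Poly_Mapping.keys m"
  then show "v \<in> V" using assms by (auto simp: polys_in_def)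
qed

lemma poly_fun_poly_eval:
  assumes "f \<in> poly_fun V"
  shows "\<exists>p\<in>polys_in V. poly_eval p = f"
  using assms
proof induction
  case (poly_fun_const c)
  have "poly_eval (Poly_Mapping.single 0 c) = (\<lambda>x. c)"
    by (simp add: poly_eval_single monomial_def fun_eq_iff)
  then show ?case by (intro bexI[of _ "Poly_Mapping.single 0 c"]) (auto simp: polys_in_def)
next
  case (poly_fun_var v)
  have "poly_eval (Poly_Mapping.single (Poly_Mapping.single v 1) 1) = (\<lambda>x. x v)"
    by (simp add: poly_eval_single monomial_def fun_eq_iff)
  then show ?case using poly_fun_var
    by (intro bexI[of _ "Poly_Mapping.single (Poly_Mapping.single v 1) 1"]) (auto simp: polys_in_def)
next
  case (poly_fun_add f g)
  then obtain p q where pq: "p \<in> polys_in V" "q \<in> polys_in V" "poly_eval p = f" "poly_eval q = g"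
    by blast
  then have "p + q \<in> polys_in V"
    using Poly_Mapping.keys_add[of p q] unfolding polys_in_def by blast
  moreover have "poly_eval (p + q) = (\<lambda>x. f x + g x)"
    using pq by (simp add: poly_eval_add fun_eq_iff)
  ultimately show ?case by (rule bexI[rotated])
next
  case (poly_fun_mult f g)
  then obtain p q where pq: "p \<in> polys_in V" "q \<in> polys_in V" "poly_eval p = f" "poly_eval q = g"
    by blast
  have "p * q \<in> polys_in V"
    unfolding polys_in_def
  proof (intro CollectI ballI)
    fix m assume "m \<in> Poly_Mapping.keys (p * q)"
    then obtain a b where "m = a + b" "a \<in> Poly_Mapping.keys p" "b \<in> Poly_Mapping.keys q"
      using Poly_Mapping.keys_mult[of p q] by blast
    then show "Poly_Mapping.keys m \<subseteq> V"
      using pq(1,2) Poly_Mapping.keys_add[of a b] unfolding polys_in_def by blast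
  qed
  moreover have "poly_eval (p * q) = (\<lambda>x. f x * g x)"
    using pq by (simp add: poly_eval_mult fun_eq_iff)
  ultimately show ?case by (rule bexI[rotated])
qed

lemma holds_genericallyD:
  assumes "holds_generically V Q"
  shows "\<exists>f\<in>poly_fun V. \<exists>a\<in>V \<rightarrow>\<^sub>E UNIV. f a \<noteq> 0 \<and> (\<forall>x\<in>V \<rightarrow>\<^sub>E UNIV. f x \<noteq> 0 \<longrightarrow> Q x)"
proof -
  obtain U F a where U: "U \<subseteq> V \<rightarrow>\<^sub>E UNIV" "a \<in> U" "\<And>x. x \<in> U \<Longrightarrow> Q x" and F: "F \<subseteq> polys_in V"
    "(V \<rightarrow>\<^sub>E UNIV) - U = {x \<in> V \<rightarrow>\<^sub>E UNIV. \<forall>f\<in>F. poly_eval f x = 0}"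
    using assms unfolding holds_generically_def affine_zariski_open_def affine_zariski_closed_def
    by blast
  then obtain f where f: "f \<in> F" "poly_eval f a \<noteq> 0" by blast
  have "poly_eval f \<in> poly_fun V" using f(1) F(1) poly_eval_poly_fun by blast
  moreover have "Q x" if "x \<in> V \<rightarrow>\<^sub>E UNIV" "poly_eval f x \<noteq> 0" for x
    using that f(1) F(2) U(3) by blast
  ultimately show ?thesis using f U by blast
qed

text \<open>\<open>F\<close> may have several members: the open set is the union of their
  nonvanishing loci. This fits the pair of real and imaginary parts, of which either may be the
  nonzero one.\<close>

lemma holds_genericallyI:
  assumes "\<And>f. f \<in> F \<Longrightarrow> f \<in> poly_fun V" "f \<in> F" "f a \<noteq> 0"
    and "\<And>x f. x \<in> V \<rightarrow>\<^sub>E UNIV \<Longrightarrow> f \<in> F \<Longrightarrow> f x \<noteq> 0 \<Longrightarrow> Q x"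
  shows "holds_generically V Q"
proof -
  define U where "U = {x \<in> V \<rightarrow>\<^sub>E UNIV. \<exists>f\<in>F. f x \<noteq> 0}"
  define P where "P = {p \<in> polys_in V. poly_eval p \<in> F}"
  have "(V \<rightarrow>\<^sub>E UNIV) - U = {x \<in> V \<rightarrow>\<^sub>E UNIV. \<forall>p\<in>P. poly_eval p x = 0}"
    using poly_fun_poly_eval assms(1) unfolding U_def P_def by blast
  then have "\<exists>P\<subseteq>polys_in V. (V \<rightarrow>\<^sub>E UNIV) - U = {x \<in> V \<rightarrow>\<^sub>E UNIV. \<forall>p\<in>P. poly_eval p x = 0}"
    by (intro exI[of _ P]) (simp add: P_def)
  then have "affine_zariski_open V U"
    unfolding affine_zariski_open_def affine_zariski_closed_def by (simp add: U_def)
  moreover have "f (restrict a V) = f a"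
    using assms(1,2) by (intro poly_fun_cong[of f V]) auto
  then have "restrict a V \<in> U" using assms(2,3) by (auto simp: U_def intro!: bexI[of _ f])
  moreover have "Q x" if "x \<in> U" for x using that assms(4) by (auto simp: U_def)
  ultimately show ?thesis unfolding holds_generically_def by blast
qed

section \<open>Points of projective space and Zariski closures\<close>

lemma equiv_proportional: "equiv (nonzero_vecs J) (proportional J)"
proof (rule equivI)
  show "proportional J \<subseteq> nonzero_vecs J \<times> nonzero_vecs J"
    by (auto simp: proportional_def)
  show "refl_on (nonzero_vecs J) (proportional J)"
    by (auto simp: refl_on_def proportional_def intro!: exI[of _ 1])
  show "sym (proportional J)"
  proof (rule symI)
    fix p q assume "(p, q) \<in> proportional J"
    then obtain c where "p \<in> nonzero_vecs J" "q \<in> nonzero_vecs J" "c \<noteq> 0" "\<forall>j\<in>J. q j = c * p j"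
      by (auto simp: proportional_def)
    then show "(q, p) \<in> proportional J"
      by (auto simp: proportional_def intro!: exI[of _ "inverse c"])
  qed
  show "trans (proportional J)"
  proof (rule transI)
    fix p q r assume "(p, q) \<in> proportional J" "(q, r) \<in> proportional J"
    then obtain c e where "p \<in> nonzero_vecs J" "r \<in> nonzero_vecs J" "c \<noteq> 0" "e \<noteq> 0"
      "\<forall>j\<in>J. q j = c * p j" "\<forall>j\<in>J. r j = e * q j"
      by (auto simp: proportional_def)
    then show "(p, r) \<in> proportional J"
      by (auto simp: proportional_def intro!: exI[of _ "e * c"])
  qed
qed

lemma proj_space_memD:
  assumes "P \<in> proj_space J" "p \<in> P" "q \<in> P"
  shows "p \<in> nonzero_vecs J" "\<exists>c. c \<noteq> 0 \<and> (\<forall>j\<in>J. q j = c * p j)"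
proof -
  have "(p, q) \<in> proportional J"
    using quotient_eq_iff[OF equiv_proportional, of P J P p q] assms by (simp add: proj_space_def)
  then show "p \<in> nonzero_vecs J" "\<exists>c. c \<noteq> 0 \<and> (\<forall>j\<in>J. q j = c * p j)"
    by (auto simp: proportional_def)
qed

lemma proj_space_nonempty: "P \<in> proj_space J \<Longrightarrow> P \<noteq> {}"
  using in_quotient_imp_non_empty[OF equiv_proportional] by (auto simp: proj_space_def)

lemma proj_space_ex_point:
  assumes "p \<in> nonzero_vecs J"
  shows "\<exists>P\<in>proj_space J. p \<in> P"
  using quotientI[OF assms, of "proportional J"] equiv_class_self[OF equiv_proportional assms]
  by (auto simp: proj_space_def)

text \<open>The constant 1, homogeneous of degree 0, has no zeros. Since the Spohn CI variety is a
  closure, its nonemptiness therefore yields an actual point off the hyperplanes.\<close>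

lemma proj_zariski_closure_empty: "proj_zariski_closure J {} = {}"
proof -
  let ?F = "{Poly_Mapping.single 0 1} :: (('a \<Rightarrow>\<^sub>0 nat) \<Rightarrow>\<^sub>0 'b) set"
  have ev: "poly_eval 1 p = 1" for p :: "'a \<Rightarrow> 'b"
    by (simp add: poly_eval_single monomial_def flip: single_one)
  have "?F \<subseteq> polys_in J \<and> (\<forall>f\<in>?F. \<exists>e. homogeneous e f) \<and>
      {} = {P \<in> proj_space J. \<forall>f\<in>?F. \<forall>p\<in>P. poly_eval f p = 0}"
    using proj_space_nonempty[of _ J] ev by (auto simp: polys_in_def homogeneous_def)
  then have "proj_zariski_closed J ({} :: ('a \<Rightarrow> 'b) set set)"
    unfolding proj_zariski_closed_def by blast
  then show ?thesis unfolding proj_zariski_closure_def by (rule hull_same)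
qed

lemma proj_zariski_closure_subset: "A \<subseteq> proj_zariski_closure J A"
  unfolding proj_zariski_closure_def by (rule hull_subset)

text \<open>A quadratic binomial is homogeneous, so its zero set is closed and contains the closure
  of \<open>A\<close> along with \<open>A\<close>. The information about closure points of the graph
  model comes from such binomials.\<close>

lemma proj_zariski_closure_binomial:
  assumes A: "A \<subseteq> proj_space J" and idx: "j \<in> J" "k \<in> J" "j' \<in> J" "k' \<in> J"
    and eq: "\<And>P p. P \<in> A \<Longrightarrow> p \<in> P \<Longrightarrow> p j * p k = p j' * p k'"
    and P: "P \<in> proj_zariski_closure J A" "p \<in> P"
  shows "p j * p k = p j' * p k'"
proof -
  let ?m = "\<lambda>j k. Poly_Mapping.single j 1 + Poly_Mapping.single k (1::nat)"
  define f where "f = Poly_Mapping.single (?m j k) 1 + Poly_Mapping.single (?m j' k') (-1::'b)"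
  have ev: "poly_eval f p = p j * p k - p j' * p k'" for p
    by (simp add: f_def poly_eval_add poly_eval_single monomial_add) (simp add: monomial_def)
  have keys: "Poly_Mapping.keys f \<subseteq> {?m j k, ?m j' k'}"
    unfolding f_def using Poly_Mapping.keys_add by (rule order_trans) auto
  have keys_m: "Poly_Mapping.keys (?m a b) = {a, b}" for a b :: 'a
    by (auto simp: in_keys_iff lookup_add lookup_single when_def split: if_splits)
  have "f \<in> polys_in J"
    using keys idx keys_m by (fastforce simp: polys_in_def)
  moreover have "homogeneous 2 f"
    unfolding homogeneous_def
  proof
    have deg: "(\<Sum>v\<in>Poly_Mapping.keys (?m a b). Poly_Mapping.lookup (?m a b) v) = 2" for a b :: 'a
      unfolding keys_m by (cases "a = b") (auto simp: lookup_add lookup_single when_def)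
    fix m assume "m \<in> Poly_Mapping.keys f"
    then show "(\<Sum>v\<in>Poly_Mapping.keys m. Poly_Mapping.lookup m v) = 2"
      using keys deg by blast
  qed
  ultimately have closed: "proj_zariski_closed J {P \<in> proj_space J. \<forall>f\<in>{f}. \<forall>p\<in>P. poly_eval f p = 0}"
    unfolding proj_zariski_closed_def by (intro exI[of _ "{f}"] conjI) auto
  have "A \<subseteq> {P \<in> proj_space J. \<forall>f\<in>{f}. \<forall>p\<in>P. poly_eval f p = 0}"
    using A eq by (auto simp: ev)
  then have "proj_zariski_closure J A \<subseteq> {P \<in> proj_space J. \<forall>f\<in>{f}. \<forall>p\<in>P. poly_eval f p = 0}"
    unfolding proj_zariski_closure_def using closed by (rule hull_minimal)
  then show ?thesis using P by (auto simp: ev)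
qed

section \<open>Nonemptiness in terms of a single coordinate vector\<close>

lemma spohn_minor_scale:
  assumes "\<And>j. j \<in> profiles d {1..n} \<Longrightarrow> q j = c * p j"
  shows "minor2 (spohn_row n d X q i r) (spohn_row n d X q i s) =
    c\<^sup>2 * minor2 (spohn_row n d X p i r) (spohn_row n d X p i s)"
proof -
  have "spohn_row n d X q i r = (c * fst (spohn_row n d X p i r), c * snd (spohn_row n d X p i r))" for r
    using assms by (auto simp: spohn_row_def sum_distrib_left intro!: sum.cong)
  then show ?thesis by (simp add: minor2_def power2_eq_square algebra_simps)
qed

abbreviation clique_product :: "nat pair_pre_digraph \<Rightarrow> (nat set \<Rightarrow> (nat \<Rightarrow> nat) \<Rightarrow> complex) \<Rightarrow> (nat \<Rightarrow> nat) \<Rightarrow> complex" where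
  "clique_product G \<sigma> j \<equiv> \<Prod>C\<in>max_cliques G. \<sigma> C (restrict j C)"

lemma spohn_CI_nonemptyI:
  fixes n d X G
  defines "J \<equiv> profiles d {1..n}"
  assumes J: "J \<noteq> {}"
    and p: "p = restrict (clique_product G \<sigma>) J"
    and nz: "\<And>j. j \<in> J \<Longrightarrow> p j \<noteq> 0" "(\<Sum>j\<in>J. p j) \<noteq> 0"
    and minors: "\<And>i r s. i \<in> {1..n} \<Longrightarrow> r \<in> {1..d i} \<Longrightarrow> s \<in> {1..d i} \<Longrightarrow>
      minor2 (spohn_row n d X p i r) (spohn_row n d X p i s) = 0"
  shows "spohn_CI_variety n d X G \<noteq> {}"
proof -
  have "p \<in> nonzero_vecs J" using J nz(1) p by (auto simp: nonzero_vecs_def)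
  then obtain P where P: "P \<in> proj_space J" "p \<in> P" using proj_space_ex_point by blast
  have "P \<in> spohn_variety n d X"
    unfolding spohn_variety_def
  proof (intro CollectI conjI ballI)
    show "P \<in> ambient n d" using P by (simp add: J_def)
    fix q i r s assume q: "q \<in> P" and irs: "i \<in> {1..n}" "r \<in> {1..d i}" "s \<in> {1..d i}"
    obtain c where "\<forall>j\<in>J. q j = c * p j" using proj_space_memD[OF P q] by blast
    then show "minor2 (spohn_row n d X q i r) (spohn_row n d X q i s) = 0"
      using spohn_minor_scale[of d n q c p X i r s] minors[OF irs] by (simp add: J_def)
  qed
  moreover have "P \<in> graph_model n d G"
    unfolding graph_model_def
    using P p by (intro subsetD[OF proj_zariski_closure_subset]) (auto simp: J_def)
  moreover have "P \<notin> special_hyperplanes n d"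
    using P nz by (auto simp: special_hyperplanes_def J_def)
  ultimately have "P \<in> spohn_variety n d X \<inter> graph_model n d G - special_hyperplanes n d" by blast
  then have "P \<in> spohn_CI_variety n d X G"
    unfolding spohn_CI_variety_def by (rule subsetD[OF proj_zariski_closure_subset])
  then show ?thesis by blast
qed

text \<open>A point of the graph model lies in a closure and need not be parametrized a priori. What
  survives are the binomials that hold identically in the parameters; as all coordinates are
  nonzero, \<open>factorize\<close> recovers parameters from them.\<close>

lemma spohn_CI_nonemptyD:
  fixes n d X G
  defines "J \<equiv> profiles d {1..n}"
  assumes "spohn_CI_variety n d X G \<noteq> {}"
  shows "\<exists>p. (\<forall>j\<in>J. p j \<noteq> 0) \<and> (\<Sum>j\<in>J. p j) \<noteq> 0 \<and>
    (\<forall>i\<in>{1..n}. \<forall>r\<in>{1..d i}. \<forall>s\<in>{1..d i}.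
      minor2 (spohn_row n d X p i r) (spohn_row n d X p i s) = 0) \<and>
    (\<forall>j\<in>J. \<forall>k\<in>J. \<forall>j'\<in>J. \<forall>k'\<in>J.
      (\<forall>\<sigma>. clique_product G \<sigma> j * clique_product G \<sigma> k =
        clique_product G \<sigma> j' * clique_product G \<sigma> k') \<longrightarrow> p j * p k = p j' * p k')"
proof -
  have "spohn_variety n d X \<inter> graph_model n d G - special_hyperplanes n d \<noteq> {}"
    using assms(2) proj_zariski_closure_empty unfolding spohn_CI_variety_def by metis
  then obtain P where P: "P \<in> spohn_variety n d X" "P \<in> graph_model n d G" "P \<notin> special_hyperplanes n d"
    by blast
  have PJ: "P \<in> proj_space J" using P(1) by (simp add: spohn_variety_def J_def)
  then obtain p where p: "p \<in> P" using proj_space_nonempty by blast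
  show ?thesis
  proof (intro exI[of _ p] conjI ballI impI)
    fix j assume j: "j \<in> J"
    then obtain q where q: "q \<in> P" "q j \<noteq> 0"
      using P(3) PJ by (auto simp: special_hyperplanes_def J_def)
    then show "p j \<noteq> 0" using proj_space_memD[OF PJ p q(1)] j by auto
  next
    obtain q where q: "q \<in> P" "(\<Sum>j\<in>J. q j) \<noteq> 0"
      using P(3) PJ by (auto simp: special_hyperplanes_def J_def)
    obtain c where "\<forall>j\<in>J. q j = c * p j" using proj_space_memD[OF PJ p q(1)] by blast
    then have "(\<Sum>j\<in>J. q j) = c * (\<Sum>j\<in>J. p j)" by (simp add: sum_distrib_left)
    then show "(\<Sum>j\<in>J. p j) \<noteq> 0" using q(2) by auto
  next
    fix i r s assume "i \<in> {1..n}" "r \<in> {1..d i}" "s \<in> {1..d i}"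
    then show "minor2 (spohn_row n d X p i r) (spohn_row n d X p i s) = 0"
      using P(1) p by (auto simp: spohn_variety_def)
  next
    fix j k j' k' assume idx: "j \<in> J" "k \<in> J" "j' \<in> J" "k' \<in> J"
      and eq: "\<forall>\<sigma>. clique_product G \<sigma> j * clique_product G \<sigma> k =
        clique_product G \<sigma> j' * clique_product G \<sigma> k'"
    let ?A = "{P \<in> ambient n d. \<exists>\<sigma>. (\<lambda>j\<in>profiles d {1..n}. clique_product G \<sigma> j) \<in> P}"
    show "p j * p k = p j' * p k'"
    proof (rule proj_zariski_closure_binomial[where A = ?A and J = J])
      show "?A \<subseteq> proj_space J" by (auto simp: J_def)
      show "P \<in> proj_zariski_closure J ?A" using P(2) by (simp add: graph_model_def J_def)
      fix Q q assume "Q \<in> ?A" and q: "q \<in> Q"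
      then obtain \<sigma> where Q: "Q \<in> proj_space J" "restrict (clique_product G \<sigma>) J \<in> Q"
        by (auto simp: J_def)
      obtain c where "\<forall>j\<in>J. q j = c * restrict (clique_product G \<sigma>) J j"
        using proj_space_memD[OF Q q] by blast
      then show "q j * q k = q j' * q k'"
        using spec[OF eq, of \<sigma>] idx by (simp add: algebra_simps)
    qed (rule idx p)+
  qed
qed

section \<open>Cluster graphs\<close>

lemma cluster_graph_same_component_iff:
  assumes "cluster_graph G" "H \<in> components G" "u \<in> verts H" "v \<in> pverts G"
  shows "v \<in> verts H \<longleftrightarrow> u = v \<or> (u, v) \<in> parcs G"
proof -
  interpret pair_graph G using assms(1) by (simp add: cluster_graph_def)
  have H: "H \<in> sccs" using assms(2) by (simp add: components_def)
  have sub: "induced_subgraph H (with_proj G)" using H by (rule in_sccs_imp_induced)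
  have "arcs_ends H = {(u, v). (u, v) \<in> verts H \<times> verts H \<and> u \<noteq> v}"
    using assms(1,2) by (simp add: cluster_graph_def complete_digraph_def)
  moreover have "arcs_ends H \<subseteq> parcs G"
    using sub by (auto simp: induced_subgraph_def subgraph_def compatible_def arcs_ends_conv)
  ultimately have "(u, v) \<in> parcs G" if "v \<in> verts H" "u \<noteq> v"
    using that assms(3) by blast
  moreover have "v \<in> verts H" if uv: "(u, v) \<in> parcs G"
  proof -
    let ?S = "{w. u \<rightarrow>\<^sup>*\<^bsub>with_proj G\<^esub> w}"
    have u: "u \<in> pverts G" using uv by (rule in_arcsD1)
    then have S: "with_proj G \<restriction> ?S \<in> sccs" by (intro induce_reachable_is_in_sccs) simp
    have "u \<rightarrow>\<^sup>*\<^bsub>with_proj G\<^esub> u" "u \<rightarrow>\<^sup>*\<^bsub>with_proj G\<^esub> v"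
      using u uv by (auto intro: reachable_adjI)
    moreover have "H = with_proj G \<restriction> ?S"
    proof (rule ccontr)
      assume "H \<noteq> with_proj G \<restriction> ?S"
      from scc_disj[OF H S this] show False
        using \<open>u \<rightarrow>\<^sup>*\<^bsub>with_proj G\<^esub> u\<close> assms(3) by auto
    qed
    ultimately show ?thesis by simp
  qed
  ultimately show ?thesis using assms(3) by blast
qed

lemma cluster_graph_components:
  assumes "cluster_graph G" and "pverts G \<noteq> {}"
  shows "max_cliques G = verts ` components G" "inj_on verts (components G)"
    "\<Union>(max_cliques G) = pverts G" "{} \<notin> max_cliques G" "disjoint (max_cliques G)"
    "isolated_vertices G = {v. {v} \<in> max_cliques G}"
proof -
  interpret pair_graph G using assms(1) by (simp add: cluster_graph_def)
  note same = cluster_graph_same_component_iff[OF assms(1)]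
  have sub: "verts H \<subseteq> pverts G" "verts H \<noteq> {}" if "H \<in> components G" for H
    using that by (auto simp: components_def sccs_def induced_subgraph_def subgraph_def strongly_connected_def)
  have ex: "\<exists>H\<in>components G. v \<in> verts H" if "v \<in> pverts G" for v
    using scc_for_vert_ex[of v] that by (auto simp: components_def)
  have clique_sub: "C \<subseteq> verts H" if "clique G C" "H \<in> components G" "u \<in> C" "u \<in> verts H" for C H u
    using that same[of H u] by (auto simp: clique_def)
  have comp_clique: "clique G (verts H)" if "H \<in> components G" for H
    using that sub[OF that] same[OF that] by (fastforce simp: clique_def)
  show eq: "max_cliques G = verts ` components G"
  proof (intro equalityI subsetI)
    fix C assume C: "C \<in> max_cliques G"
    \<comment> \<open>In a graph without vertices the empty clique would be maximal; here any vertex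
      gives a larger one.\<close>
    obtain v where v: "v \<in> C"
    proof (cases "C = {}")
      case True
      obtain v where "v \<in> pverts G" using assms(2) by blast
      then have "clique G {v}" by (simp add: clique_def)
      then show ?thesis using C True by (auto simp: max_cliques_def)
    qed blast
    then obtain H where H: "H \<in> components G" "v \<in> verts H"
      using C ex[of v] by (auto simp: max_cliques_def clique_def)
    then have "C \<subseteq> verts H" using clique_sub v C by (auto simp: max_cliques_def)
    then have "C = verts H" using C comp_clique[OF H(1)] by (auto simp: max_cliques_def)
    then show "C \<in> verts ` components G" using H by blast
  next
    fix C assume "C \<in> verts ` components G"
    then obtain H where H: "H \<in> components G" "C = verts H" by blast
    then obtain u where "u \<in> verts H" using sub by blast
    then show "C \<in> max_cliques G"
      using H comp_clique clique_sub[OF _ H(1), of _ u] unfolding max_cliques_def by blast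
  qed
  show "inj_on verts (components G)"
    unfolding components_def by (rule inj_on_verts_sccs)
  show "\<Union>(max_cliques G) = pverts G" unfolding eq using ex sub(1) by auto
  show "{} \<notin> max_cliques G" unfolding eq using sub(2) by auto
  show "disjoint (max_cliques G)"
    unfolding eq components_def disjoint_def using scc_disj by blast
  show "isolated_vertices G = {v. {v} \<in> max_cliques G}"
  proof (intro equalityI subsetI)
    fix v assume "v \<in> isolated_vertices G"
    then have v: "v \<in> pverts G" "\<And>w. (v, w) \<notin> parcs G" by (auto simp: isolated_vertices_def)
    obtain H where H: "H \<in> components G" "v \<in> verts H" using ex v by blast
    then have "verts H = {v}" using same[OF H] sub v by blast
    then show "v \<in> {v. {v} \<in> max_cliques G}" using H eq by force
  next
    fix v assume "v \<in> {v. {v} \<in> max_cliques G}"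
    then obtain H where H: "H \<in> components G" "verts H = {v}" using eq by force
    have "(v, w) \<notin> parcs G" for w
      using same[OF H(1), of v w] H(2) pair_no_loops[of "(v, w)"] in_arcsD2[of v w] by auto
    then show "v \<in> isolated_vertices G" using sub[OF H(1)] H(2) by (auto simp: isolated_vertices_def)
  qed
qed

section \<open>Games without solutions\<close>

text \<open>\<open>K\<close> is the set of maximal cliques of a cluster graph, that is, the partition of the players
  into the vertex sets of the complete graphs.\<close>

locale player_partition =
  fixes n :: nat and d :: "nat \<Rightarrow> nat" and K :: "nat set set"
  assumes d_ge_2: "\<And>i. i \<in> {1..n} \<Longrightarrow> 2 \<le> d i"
    and Union_K: "\<Union>K = {1..n}"
    and empty_notin_K: "{} \<notin> K"
    and disjoint_K: "disjoint K"
begin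

abbreviation J where "J \<equiv> profiles d {1..n}"

definition blocks :: "(nat set \<Rightarrow> (nat \<Rightarrow> nat) \<Rightarrow> 'a::comm_monoid_mult) \<Rightarrow> (nat \<Rightarrow> nat) \<Rightarrow> 'a" where
  "blocks \<sigma> j = (\<Prod>C\<in>K. \<sigma> C (restrict j C))"

lemma finite_K: "finite K"
  using finite_UnionD[of K] Union_K by simp

lemma K_subset: "C \<in> K \<Longrightarrow> C \<subseteq> {1..n}"
  using Union_K by blast

lemma finite_block: "C \<in> K \<Longrightarrow> finite C"
  using K_subset finite_subset by blast

lemma K_disjoint: "C \<in> K \<Longrightarrow> C' \<in> K \<Longrightarrow> C \<noteq> C' \<Longrightarrow> C \<inter> C' = {}"
  using disjoint_K by (auto simp: disjoint_def)

lemma the_block: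
  assumes "C \<in> K" "k \<in> C"
  shows "(THE C. C \<in> K \<and> k \<in> C) = C"
  using K_disjoint[OF assms(1)] assms by (intro the_equality) auto

lemma finite_profiles: "C \<in> K \<Longrightarrow> finite (profiles d C)"
  unfolding profiles_def using finite_block by (intro finite_PiE) auto

lemma finite_J: "finite J"
  unfolding profiles_def by (intro finite_PiE) auto

lemma restrict_profile: "j \<in> J \<Longrightarrow> C \<in> K \<Longrightarrow> restrict j C \<in> profiles d C"
  using K_subset by (fastforce simp: profiles_def)

lemma override_profile:
  "j \<in> J \<Longrightarrow> k \<in> J \<Longrightarrow> (\<lambda>i. if i \<in> S then k i else j i) \<in> J"
  by (auto simp: profiles_def PiE_iff extensional_def)

lemma upd_profile: "j \<in> J \<Longrightarrow> i \<in> {1..n} \<Longrightarrow> r \<in> {1..d i} \<Longrightarrow> j(i := r) \<in> J"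
  by (auto simp: profiles_def PiE_iff extensional_def)

lemma one_profile: "(\<lambda>i\<in>{1..n}. 1) \<in> J"
  using d_ge_2 by (fastforce simp: profiles_def)

lemma restrict_override:
  assumes "C \<in> K" "C' \<in> K"
  shows "restrict (\<lambda>i. if i \<in> C then k i else j i) C' = (if C' = C then restrict k C else restrict j C')"
  using K_disjoint[OF assms] by (fastforce simp: fun_eq_iff)

text \<open>In every block the same two factors occur on both sides, in exchanged order for
  \<open>C\<close>. These are quadrics satisfied by the Segre variety.\<close>

lemma blocks_swap:
  fixes \<sigma> :: "nat set \<Rightarrow> (nat \<Rightarrow> nat) \<Rightarrow> 'a::comm_monoid_mult"
  assumes "C \<in> K"
  shows "blocks \<sigma> j * blocks \<sigma> k =
    blocks \<sigma> (\<lambda>i. if i \<in> C then k i else j i) * blocks \<sigma> (\<lambda>i. if i \<in> C then j i else k i)"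
proof -
  have "(\<Prod>C'\<in>K. \<sigma> C' (restrict j C') * \<sigma> C' (restrict k C')) =
    (\<Prod>C'\<in>K. \<sigma> C' (restrict (\<lambda>i. if i \<in> C then k i else j i) C') *
      \<sigma> C' (restrict (\<lambda>i. if i \<in> C then j i else k i) C'))"
    by (rule prod.cong[OF refl]) (simp only: restrict_override[OF assms], simp add: mult.commute)
  then show ?thesis by (simp add: blocks_def prod.distrib)
qed

text \<open>Fix a base profile \<open>a\<close> and let \<open>\<sigma> C b\<close> be the factor by
  which \<open>p\<close> changes when block \<open>C\<close> of \<open>a\<close> is replaced by
  \<open>b\<close>. Replacing the blocks one at a time, the exchange relation shows that these
  factors multiply.\<close>

lemma factorize:
  fixes p :: "(nat \<Rightarrow> nat) \<Rightarrow> complex"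
  assumes nz: "\<And>j. j \<in> J \<Longrightarrow> p j \<noteq> 0"
    and swap: "\<And>C j k. C \<in> K \<Longrightarrow> j \<in> J \<Longrightarrow> k \<in> J \<Longrightarrow>
      p j * p k = p (\<lambda>i. if i \<in> C then k i else j i) * p (\<lambda>i. if i \<in> C then j i else k i)"
  shows "\<exists>c \<sigma>. c \<noteq> 0 \<and> (\<forall>C\<in>K. \<forall>b\<in>profiles d C. \<sigma> C b \<noteq> 0) \<and> (\<forall>j\<in>J. p j = c * blocks \<sigma> j)"
proof -
  define a where "a = (\<lambda>i\<in>{1..n}. 1::nat)"
  have a: "a \<in> J" unfolding a_def by (rule one_profile)
  define \<sigma> where "\<sigma> C b = p (\<lambda>i. if i \<in> C then b i else a i) / p a" for C b
  have blk: "(\<lambda>i. if i \<in> C then b i else a i) \<in> J" if "C \<in> K" "b \<in> profiles d C" for C b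
    using that a K_subset[OF that(1)] by (auto simp: profiles_def PiE_iff extensional_def)
  have part: "p (\<lambda>i. if i \<in> \<Union>L then j i else a i) = p a * (\<Prod>C\<in>L. \<sigma> C (restrict j C))"
    if "L \<subseteq> K" "j \<in> J" for L j
    using finite_subset[OF that(1) finite_K] that(1)
  proof (induction L rule: finite_induct)
    case (insert C L)
    let ?u = "\<lambda>i. if i \<in> \<Union>(insert C L) then j i else a i"
    have C: "C \<in> K" and "\<And>D. D \<in> L \<Longrightarrow> C \<inter> D = {}"
      using insert K_disjoint[of C] by auto
    then have dis: "i \<notin> \<Union>L" if "i \<in> C" for i using that by blast
    have u: "?u \<in> J" by (rule override_profile[OF a that(2)])
    have "p ?u * p a = p (\<lambda>i. if i \<in> C then a i else ?u i) * p (\<lambda>i. if i \<in> C then ?u i else a i)"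
      by (rule swap[OF C u a])
    also have "(\<lambda>i. if i \<in> C then a i else ?u i) = (\<lambda>i. if i \<in> \<Union>L then j i else a i)"
      using dis by (auto simp: fun_eq_iff)
    also have "(\<lambda>i. if i \<in> C then ?u i else a i) = (\<lambda>i. if i \<in> C then restrict j C i else a i)"
      by (auto simp: fun_eq_iff)
    also have "p \<dots> = p a * \<sigma> C (restrict j C)"
      using nz[OF a] by (simp add: \<sigma>_def)
    also have "p (\<lambda>i. if i \<in> \<Union>L then j i else a i) = p a * (\<Prod>C\<in>L. \<sigma> C (restrict j C))"
      using insert by blast
    finally have "p ?u * p a = p a * (\<sigma> C (restrict j C) * (\<Prod>C\<in>L. \<sigma> C (restrict j C))) * p a"
      by (simp only: mult_ac)
    then show ?case
      unfolding prod.insert[OF insert.hyps] by (simp only: mult_right_cancel[OF nz[OF a]])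
  qed (simp)
  have "p j = p a * blocks \<sigma> j" if j: "j \<in> J" for j
  proof -
    have "(\<lambda>i. if i \<in> \<Union>K then j i else a i) = j"
      unfolding Union_K using a j by (auto simp: fun_eq_iff profiles_def PiE_iff extensional_def)
    then show ?thesis using part[of K j] j by (simp add: blocks_def)
  qed
  moreover have "\<sigma> C b \<noteq> 0" if "C \<in> K" "b \<in> profiles d C" for C b
    using nz[OF a] nz[OF blk[OF that]] by (simp add: \<sigma>_def)
  ultimately show ?thesis using nz[OF a] by blast
qed

text \<open>For an isolated player \<open>i\<close> and \<open>\<sigma>\<close> off \<open>\<W>\<close>, the minors say that all pure strategies \<open>r\<close> of \<open>i\<close>
  have the same expected payoff \<open>payoff X \<sigma> i r\<close>, up to a common factor.\<close>

definition slice where "slice i = {j \<in> J. j i = 1}"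

definition payoff :: "game \<Rightarrow> (nat set \<Rightarrow> (nat \<Rightarrow> nat) \<Rightarrow> complex) \<Rightarrow> nat \<Rightarrow> nat \<Rightarrow> complex" where
  "payoff X \<sigma> i r = (\<Sum>j\<in>slice i. complex_of_real (X (i, j(i := r))) * (\<Prod>C\<in>K - {{i}}. \<sigma> C (restrict j C)))"

lemma slice_reindex:
  assumes "i \<in> {1..n}" "r \<in> {1..d i}"
  shows "(\<Sum>j\<in>{j \<in> J. j i = r}. f j) = (\<Sum>j\<in>slice i. f (j(i := r)))"
  unfolding slice_def
  by (rule sum.reindex_bij_witness[of _ "\<lambda>j. j(i := r)" "\<lambda>j. j(i := 1)"])
    (use assms upd_profile d_ge_2 in \<open>auto\<close>)

lemma blocks_isolated:
  assumes "{i} \<in> K" "r \<in> {1..d i}" "j \<in> slice i"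
  shows "blocks \<sigma> (j(i := r)) = \<sigma> {i} (\<lambda>_\<in>{i}. r) * (\<Prod>C\<in>K - {{i}}. \<sigma> C (restrict j C))"
proof -
  have "restrict (j(i := r)) C = restrict j C" if "C \<in> K - {{i}}" for C
    using K_disjoint[OF assms(1), of C] that by (auto simp: fun_eq_iff)
  moreover have "restrict (j(i := r)) {i} = (\<lambda>_\<in>{i}. r)" by auto
  ultimately show ?thesis
    unfolding blocks_def by (subst prod.remove[OF finite_K assms(1)]) simp
qed

text \<open>Row \<open>r\<close> of the matrix is \<open>q r\<close> times
  \<open>(W, payoff X \<sigma> i r)\<close>, with \<open>W\<close> independent of \<open>r\<close>.
  The scalars \<open>q r\<close> are nonzero, and so is \<open>W\<close>, because it divides the sum
  of all coordinates; the minor then reduces to a difference of payoffs.\<close>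

lemma minors_payoff_eq:
  assumes p: "\<And>j. j \<in> J \<Longrightarrow> p j = c * blocks \<sigma> j" "(\<Sum>j\<in>J. p j) \<noteq> 0"
    and nz: "c \<noteq> 0" "\<And>C b. C \<in> K \<Longrightarrow> b \<in> profiles d C \<Longrightarrow> \<sigma> C b \<noteq> 0"
    and i: "{i} \<in> K"
    and minor: "\<And>r s. r \<in> {1..d i} \<Longrightarrow> s \<in> {1..d i} \<Longrightarrow>
      minor2 (spohn_row n d X p i r) (spohn_row n d X p i s) = 0"
    and rs: "r \<in> {1..d i}" "s \<in> {1..d i}"
  shows "payoff X \<sigma> i r = payoff X \<sigma> i s"
proof -
  have i': "i \<in> {1..n}" using K_subset[OF i] by simp
  define q where "q r = c * \<sigma> {i} (\<lambda>_\<in>{i}. r)" for r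
  define W where "W = (\<Sum>j\<in>slice i. \<Prod>C\<in>K - {{i}}. \<sigma> C (restrict j C))"
  have q: "q r \<noteq> 0" if "r \<in> {1..d i}" for r
    using nz(1) nz(2)[OF i, of "\<lambda>_\<in>{i}. r"] that by (auto simp: q_def profiles_def)
  have pj: "p (j(i := r)) = q r * (\<Prod>C\<in>K - {{i}}. \<sigma> C (restrict j C))"
    if "j \<in> slice i" "r \<in> {1..d i}" for j r
    using p(1)[of "j(i := r)"] upd_profile[of j i r] that i' blocks_isolated[OF i that(2,1), of \<sigma>]
    by (simp add: slice_def q_def)
  have A: "(\<Sum>j\<in>{j \<in> J. j i = r}. p j) = q r * W" if "r \<in> {1..d i}" for r
    unfolding slice_reindex[OF i' that] W_def sum_distrib_left using that by (simp add: pj)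
  have "W \<noteq> 0"
  proof
    assume "W = 0"
    have "(\<Sum>j\<in>J. p j) = (\<Sum>r\<in>{1..d i}. \<Sum>j\<in>{j \<in> J. j i = r}. p j)"
      using i' by (intro sum.group[symmetric] finite_J) (auto simp: profiles_def PiE_iff)
    also have "\<dots> = 0" using A \<open>W = 0\<close> by simp
    finally show False using p(2) by simp
  qed
  have B: "(\<Sum>j\<in>{j \<in> J. j i = r}. complex_of_real (X (i, j)) * p j) = q r * payoff X \<sigma> i r"
    if "r \<in> {1..d i}" for r
    unfolding slice_reindex[OF i' that] payoff_def sum_distrib_left
    using that by (intro sum.cong) (simp_all add: pj)
  have "q r * q s * W * (payoff X \<sigma> i s - payoff X \<sigma> i r) = 0"
    using minor[OF rs] A B rs by (simp add: minor2_def spohn_row_def algebra_simps)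
  then show ?thesis using q[OF rs(1)] q[OF rs(2)] \<open>W \<noteq> 0\<close> by simp
qed

lemma payoff_scale:
  assumes "\<And>C b. \<sigma>' C b = e C * \<sigma> C b"
  shows "payoff X \<sigma>' i r = (\<Prod>C\<in>K - {{i}}. e C) * payoff X \<sigma> i r"
  by (simp add: payoff_def assms prod.distrib sum_distrib_left algebra_simps)

text \<open>The game is such that the payoffs of \<open>i\<close> are \<open>0\<close> and the coefficients of a product of univariate
  polynomials, one for each block \<open>C\<close> other than \<open>{i}\<close>, with coefficients \<open>\<sigma> C b\<close>; if all of them
  agree then one of the factors vanishes.\<close>

lemma ex_game_without_solution:
  assumes i: "{i} \<in> K" and dim: "(\<Sum>C\<in>K - {{i}}. card (profiles d C) - 1) < d i - 1"
  shows "\<exists>X. \<forall>\<sigma>. (\<forall>r\<in>{1..d i}. payoff X \<sigma> i r = payoff X \<sigma> i 1) \<longrightarrow>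
    (\<exists>C\<in>K - {{i}}. \<forall>b\<in>profiles d C. \<sigma> C b = 0)"
proof -
  define K' where "K' = K - {{i}}"
  have K': "finite K'" "K' \<subseteq> K" "{i} \<notin> K'" using finite_K by (auto simp: K'_def)
  have "\<exists>h. bij_betw h (profiles d C) {0..<card (profiles d C)}" if "C \<in> K'" for C
    using that K' finite_profiles by (intro ex_bij_betw_finite_nat) auto
  then obtain code where code: "\<And>C. C \<in> K' \<Longrightarrow> bij_betw (code C) (profiles d C) {0..<card (profiles d C)}"
    by metis
  \<comment> \<open>Strategies 2, ..., \<open>d i\<close> correspond to the exponents 0, ...,
    \<open>d i - 2\<close>. Strategy 1 has payoff 0, so equal payoffs make all these coefficients
    vanish.\<close>
  define X :: game where "X = (\<lambda>(_, j). if j i = 1 then 0 else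
    of_bool ((\<Sum>C\<in>K'. code C (restrict j C)) = j i - 2))"
  have i': "i \<in> {1..n}" using K_subset[OF i] by simp
  have iC: "i \<notin> C" if "C \<in> K'" for C
    using that K_disjoint[OF i, of C] by (auto simp: K'_def)
  show ?thesis
  proof (intro exI[of _ X] allI impI)
    fix \<sigma> assume eq: "\<forall>r\<in>{1..d i}. payoff X \<sigma> i r = payoff X \<sigma> i 1"
    define F where "F C = (\<Sum>b\<in>profiles d C. monom (\<sigma> C b) (code C b))" for C
    \<comment> \<open>Expanding the product chooses one profile in each block other than
      \<open>{i}\<close>, and such choices are in bijection with \<open>slice i\<close>.\<close>
    have F: "(\<Prod>C\<in>K'. F C) = (\<Sum>j\<in>slice i.
        monom (\<Prod>C\<in>K'. \<sigma> C (restrict j C)) (\<Sum>C\<in>K'. code C (restrict j C)))"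
    proof -
      have mono: "(\<Prod>C\<in>L. monom (f C) (e C)) = monom (\<Prod>C\<in>L. f C) (\<Sum>C\<in>L. e C)"
        if "finite L" for L and f :: "nat set \<Rightarrow> complex" and e
        using that by (induction L rule: finite_induct) (auto simp: mult_monom monom_0 one_pCons)
      have "(\<Prod>C\<in>K'. F C) = (\<Sum>g\<in>Pi\<^sub>E K' (profiles d). \<Prod>C\<in>K'. monom (\<sigma> C (g C)) (code C (g C)))"
        unfolding F_def using K' finite_profiles by (intro prod_sum_PiE) auto
      also have "\<dots> = (\<Sum>j\<in>slice i. \<Prod>C\<in>K'. monom (\<sigma> C (restrict j C)) (code C (restrict j C)))"
      proof (rule sum.reindex_bij_witness[of _ "\<lambda>j. \<lambda>C\<in>K'. restrict j C"
            "\<lambda>g. \<lambda>k\<in>{1..n}. if k = i then 1 else g (THE C. C \<in> K \<and> k \<in> C) k"])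
        fix g assume g: "g \<in> Pi\<^sub>E K' (profiles d)"
        let ?j = "\<lambda>k\<in>{1..n}. if k = i then 1 else g (THE C. C \<in> K \<and> k \<in> C) k"
        have res: "restrict ?j C = g C" if "C \<in> K'" for C
        proof
          have C: "C \<in> K" "C \<subseteq> {1..n}" "g C \<in> profiles d C" "i \<notin> C"
            using that K' K_subset g iC by (auto simp: PiE_iff)
          show "restrict ?j C k = g C k" for k
            using C the_block[OF C(1), of k] by (cases "k \<in> C") (auto simp: profiles_def PiE_iff extensional_def)
        qed
        show "(\<lambda>C\<in>K'. restrict ?j C) = g"
          using res g by (auto simp: fun_eq_iff PiE_iff extensional_def)
        show "?j \<in> slice i"
        proof -
          have "?j k \<in> {1..d k}" if k: "k \<in> {1..n}" for k
          proof (cases "k = i")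
            case True
            then show ?thesis using d_ge_2[OF i'] i' by simp
          next
            case False
            obtain C where C: "C \<in> K" "k \<in> C" using k Union_K by blast
            then have "C \<in> K'" using False by (auto simp: K'_def)
            then have "g C k \<in> {1..d k}" using g C by (auto simp: PiE_iff profiles_def)
            then show ?thesis using the_block[OF C] k False by simp
          qed
          then show ?thesis using i' by (auto simp: slice_def profiles_def)
        qed
        show "(\<Prod>C\<in>K'. monom (\<sigma> C (restrict ?j C)) (code C (restrict ?j C))) =
            (\<Prod>C\<in>K'. monom (\<sigma> C (g C)) (code C (g C)))"
          by (rule prod.cong) (simp_all only: res)
      next
        fix j assume j: "j \<in> slice i"
        then have jJ: "j \<in> J" "j i = 1" by (auto simp: slice_def)
        show "(\<lambda>C\<in>K'. restrict j C) \<in> Pi\<^sub>E K' (profiles d)"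
          using restrict_profile[OF jJ(1)] K' by auto
        show "(\<lambda>k\<in>{1..n}. if k = i then 1 else (\<lambda>C\<in>K'. restrict j C) (THE C. C \<in> K \<and> k \<in> C) k) = j"
        proof
          fix k
          show "(\<lambda>k\<in>{1..n}. if k = i then 1 else (\<lambda>C\<in>K'. restrict j C) (THE C. C \<in> K \<and> k \<in> C) k) k = j k"
          proof (cases "k \<in> {1..n} \<and> k \<noteq> i")
            case True
            then obtain C where C: "C \<in> K" "k \<in> C" using Union_K by blast
            then have "C \<in> K'" using True by (auto simp: K'_def)
            then show ?thesis using True the_block[OF C] C by simp
          next
            case False
            then show ?thesis using jJ i' by (auto simp: profiles_def PiE_iff extensional_def)
          qed
        qed
      qed
      finally show ?thesis using mono K' by simp
    qed
    have low: "coeff (\<Prod>C\<in>K'. F C) s = 0" if s: "s + 2 \<le> d i" for s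
    proof -
      have "restrict (j(i := r)) C = restrict j C" if "C \<in> K'" for C j and r :: nat
        using iC[OF that] by (auto simp: fun_eq_iff)
      then have "payoff X \<sigma> i (s + 2) = coeff (\<Prod>C\<in>K'. F C) s" "payoff X \<sigma> i 1 = 0"
        unfolding F coeff_sum payoff_def K'_def[symmetric]
        by (auto simp: X_def of_bool_def intro!: sum.cong)
      then show ?thesis using bspec[OF eq, of "s + 2"] s by simp
    qed
    have deg: "degree (F C) \<le> card (profiles d C) - 1" if "C \<in> K'" for C
      unfolding F_def
    proof (rule degree_sum_le)
      show "finite (profiles d C)" using that K' finite_profiles by blast
      fix b assume "b \<in> profiles d C"
      then have "code C b < card (profiles d C)" using code[OF that] by (auto dest: bij_betwE)
      then show "degree (monom (\<sigma> C b) (code C b)) \<le> card (profiles d C) - 1"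
        by (intro order_trans[OF degree_monom_le]) simp
    qed
    \<comment> \<open>The degree is at most \<open>d i - 2\<close>, so the leading coefficient lies
      in the range where all coefficients vanish.\<close>
    have "degree (\<Prod>C\<in>K'. F C) \<le> (\<Sum>C\<in>K'. degree (F C))"
      using degree_prod_sum_le[OF K'(1), of F] by (simp add: o_def)
    also have "\<dots> \<le> (\<Sum>C\<in>K'. card (profiles d C) - 1)" by (intro sum_mono deg)
    also have "\<dots> < d i - 1" using dim by (simp add: K'_def)
    finally have "lead_coeff (\<Prod>C\<in>K'. F C) = 0" by (intro low) simp
    then have "(\<Prod>C\<in>K'. F C) = 0" by simp
    then obtain C where C: "C \<in> K'" "F C = 0" using K' by auto
    have "\<sigma> C b = 0" if b: "b \<in> profiles d C" for b
    proof -
      have "coeff (F C) (code C b) = (\<Sum>b'\<in>profiles d C. if b' = b then \<sigma> C b' else 0)"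
        unfolding F_def coeff_sum using code[OF C(1)] b
        by (intro sum.cong) (auto simp: bij_betw_def inj_on_def)
      also have "\<dots> = \<sigma> C b" using b C K' finite_profiles[of C] by auto
      finally show ?thesis using C by simp
    qed
    then show "\<exists>C\<in>K - {{i}}. \<forall>b\<in>profiles d C. \<sigma> C b = 0" using C by (auto simp: K'_def)
  qed
qed

end

section \<open>The compactness argument\<close>

lemma convergent_subseq_finite:
  fixes s :: "nat \<Rightarrow> 'v \<Rightarrow> complex"
  assumes "finite I" "\<And>m v. v \<in> I \<Longrightarrow> cmod (s m v) \<le> 1"
  shows "\<exists>r l. strict_mono r \<and> (\<forall>v\<in>I. (\<lambda>m. s (r m) v) \<longlonglongrightarrow> l v)"
  using assms
proof (induction I rule: finite_induct)
  case empty
  then show ?case by (auto intro: exI[of _ id] simp: strict_mono_def)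
next
  case (insert w I)
  then obtain r l where r: "strict_mono r" "\<forall>v\<in>I. (\<lambda>m. s (r m) v) \<longlonglongrightarrow> l v"
    by (meson insertCI)
  have "\<forall>m. cmod (s (r m) w) \<le> 1" using insert.prems by simp
  from Bolzano_Weierstrass_complex_disc[OF this] obtain f :: "nat \<Rightarrow> nat" and z where f: "strict_mono f"
    "\<forall>e>0. \<exists>N. \<forall>n\<ge>N. cmod (s (r (f n)) w - z) < e" by blast
  have "(\<lambda>m. s ((r \<circ> f) m) v) \<longlonglongrightarrow> (l(w := z)) v" if "v \<in> insert w I" for v
  proof (cases "v = w")
    case True
    then show ?thesis using f(2) by (simp add: LIMSEQ_iff)
  next
    case False
    then show ?thesis using that LIMSEQ_subseq_LIMSEQ[OF r(2)[rule_format] f(1), of v] by (simp add: o_def)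
  qed
  then show ?case using strict_mono_o[OF r(1) f(1)] by blast
qed


text \<open>Rescaling the blocks multiplies all payoffs of \<open>i\<close> by a common factor.
  Normalizing the sums of moduli to 1 confines the parameters to a compact set in which no block is
  zero.\<close>

lemma (in player_partition) normalized_solution:
  assumes "K = max_cliques G" "{i} \<in> K" "spohn_CI_variety n d X G \<noteq> {}"
  shows "\<exists>\<sigma>. (\<forall>C\<in>K. (\<Sum>b\<in>profiles d C. cmod (\<sigma> C b)) = 1) \<and>
    (\<forall>r\<in>{1..d i}. payoff X \<sigma> i r = payoff X \<sigma> i 1)"
proof -
  have i: "i \<in> {1..n}" using K_subset[OF assms(2)] by simp
  obtain p where p: "\<forall>j\<in>J. p j \<noteq> 0" "(\<Sum>j\<in>J. p j) \<noteq> 0"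
    "\<forall>i\<in>{1..n}. \<forall>r\<in>{1..d i}. \<forall>s\<in>{1..d i}.
      minor2 (spohn_row n d X p i r) (spohn_row n d X p i s) = 0"
    and bin: "\<forall>j\<in>J. \<forall>k\<in>J. \<forall>j'\<in>J. \<forall>k'\<in>J.
      (\<forall>\<sigma>. clique_product G \<sigma> j * clique_product G \<sigma> k =
        clique_product G \<sigma> j' * clique_product G \<sigma> k') \<longrightarrow> p j * p k = p j' * p k'"
    using spohn_CI_nonemptyD[OF assms(3)] by (elim exE conjE)
  have swap: "p j * p k = p (\<lambda>i. if i \<in> C then k i else j i) * p (\<lambda>i. if i \<in> C then j i else k i)"
    if "C \<in> K" "j \<in> J" "k \<in> J" for C j k
    using blocks_swap[OF that(1), of _ j k] that
    by (intro bin[rule_format] override_profile) (simp_all add: blocks_def flip: assms(1))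
  from factorize[OF p(1)[rule_format] swap] obtain c \<sigma> where c: "c \<noteq> 0"
    and \<sigma>: "\<And>C b. C \<in> K \<Longrightarrow> b \<in> profiles d C \<Longrightarrow> \<sigma> C b \<noteq> 0"
    and pj: "\<And>j. j \<in> J \<Longrightarrow> p j = c * blocks \<sigma> j" by blast
  define N where "N C = (\<Sum>b\<in>profiles d C. cmod (\<sigma> C b))" for C
  define \<sigma>' where "\<sigma>' C b = inverse (complex_of_real (N C)) * \<sigma> C b" for C b
  have N: "N C > 0" if C: "C \<in> K" for C
    unfolding N_def
  proof (rule sum_pos)
    show "profiles d C \<noteq> {}" using restrict_profile[OF one_profile C] by blast
  qed (use C finite_profiles \<sigma> in auto)
  have "(\<Sum>b\<in>profiles d C. cmod (\<sigma>' C b)) = 1" if "C \<in> K" for C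
    using N[OF that] by (simp add: \<sigma>'_def norm_mult norm_inverse flip: sum_distrib_left N_def)
  moreover have "payoff X \<sigma>' i r = payoff X \<sigma>' i 1" if r: "r \<in> {1..d i}" for r
  proof -
    have one: "1 \<in> {1..d i}" using d_ge_2[OF i] by simp
    have "payoff X \<sigma> i r = payoff X \<sigma> i 1"
      by (rule minors_payoff_eq[OF pj p(2) c \<sigma> assms(2) p(3)[rule_format, OF i] r one])
    then show ?thesis unfolding payoff_scale[OF \<sigma>'_def] by simp
  qed
  ultimately show ?thesis by blast
qed

text \<open>On the line from \<open>X0\<close> to a game where \<open>f\<close> is nonzero,
  \<open>f\<close> has finitely many zeros, so solvable games would accumulate at \<open>X0\<close>.
  A limit of their normalized parameters gives equal payoffs in \<open>X0\<close> with no block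
  zero, which the choice of \<open>X0\<close> forbids.\<close>

lemma (in player_partition) not_generically_nonempty:
  assumes K: "K = max_cliques G" and i: "{i} \<in> K"
    and dim: "(\<Sum>C\<in>K - {{i}}. card (profiles d C) - 1) < d i - 1"
  shows "\<not> holds_generically (game_coords n d) (\<lambda>X. spohn_CI_variety n d X G \<noteq> {})"
proof
  assume "holds_generically (game_coords n d) (\<lambda>X. spohn_CI_variety n d X G \<noteq> {})"
  then obtain f a where f: "f \<in> poly_fun (game_coords n d)" "f a \<noteq> 0"
    "\<And>X. X \<in> game_coords n d \<rightarrow>\<^sub>E UNIV \<Longrightarrow> f X \<noteq> 0 \<Longrightarrow> spohn_CI_variety n d X G \<noteq> {}"
    by (drule_tac holds_genericallyD) blast
  obtain X0 where X0: "\<And>\<sigma>. \<forall>r\<in>{1..d i}. payoff X0 \<sigma> i r = payoff X0 \<sigma> i 1 \<Longrightarrow>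
    \<exists>C\<in>K - {{i}}. \<forall>b\<in>profiles d C. \<sigma> C b = 0"
    using ex_game_without_solution[OF i dim] by blast
  have i': "i \<in> {1..n}" using K_subset[OF i] by simp
  define X where "X t = restrict (\<lambda>v. X0 v + t * (a v - X0 v)) (game_coords n d)" for t
  obtain P where P: "\<And>t x. f (\<lambda>v. X0 v + t * x v) = poly (P x) t"
    using poly_fun_line[OF f(1), of X0] by blast
  define Q where "Q = P (\<lambda>v. a v - X0 v)"
  have fX: "f (X t) = poly Q t" for t
  proof -
    have "f (X t) = f (\<lambda>v. X0 v + t * (a v - X0 v))"
      by (rule poly_fun_cong[OF f(1)]) (simp add: X_def)
    then show ?thesis by (simp add: P Q_def)
  qed
  have "Q \<noteq> 0" using P[of 1 "\<lambda>v. a v - X0 v"] f(2) by (auto simp: Q_def)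
  then have "finite {t. poly Q t = 0}" by (rule poly_roots_finite)
  then have "finite ((\<lambda>m. inverse (real (Suc m))) -` {t. poly Q t = 0})"
    by (rule finite_vimageI) (auto simp: inj_def)
  then obtain M where M: "\<And>m. m \<ge> M \<Longrightarrow> poly Q (inverse (real (Suc m))) \<noteq> 0"
    using finite_nat_set_iff_bounded[of "(\<lambda>m. inverse (real (Suc m))) -` {t. poly Q t = 0}"]
    by (auto simp: not_less[symmetric])
  define t where "t m = inverse (real (Suc (m + M)))" for m
  have t: "t \<longlonglongrightarrow> 0"
    using LIMSEQ_ignore_initial_segment[OF LIMSEQ_inverse_real_of_nat, of M] unfolding t_def .
  have "\<exists>\<sigma>. (\<forall>C\<in>K. (\<Sum>b\<in>profiles d C. cmod (\<sigma> C b)) = 1) \<and>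
      (\<forall>r\<in>{1..d i}. payoff (X (t m)) \<sigma> i r = payoff (X (t m)) \<sigma> i 1)" for m
  proof (rule normalized_solution[OF K i], rule f(3))
    show "X (t m) \<in> game_coords n d \<rightarrow>\<^sub>E UNIV" by (simp add: X_def)
    show "f (X (t m)) \<noteq> 0" using M[of "m + M"] by (simp add: fX t_def)
  qed
  then obtain \<sigma> where norm: "\<And>m C. C \<in> K \<Longrightarrow> (\<Sum>b\<in>profiles d C. cmod (\<sigma> m C b)) = 1"
    and sol: "\<And>m r. r \<in> {1..d i} \<Longrightarrow> payoff (X (t m)) (\<sigma> m) i r = payoff (X (t m)) (\<sigma> m) i 1"
    by metis
  have "\<exists>h l. strict_mono h \<and> (\<forall>v\<in>Sigma K (profiles d).
      (\<lambda>m. (\<lambda>(C, b). \<sigma> (h m) C b) v) \<longlonglongrightarrow> l v)"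
  proof (rule convergent_subseq_finite)
    show "finite (Sigma K (profiles d))" using finite_K finite_profiles by auto
    fix m v assume "v \<in> Sigma K (profiles d)"
    then obtain C b where v: "v = (C, b)" "C \<in> K" "b \<in> profiles d C" by auto
    have "cmod (\<sigma> m C b) \<le> (\<Sum>b\<in>profiles d C. cmod (\<sigma> m C b))"
      using v finite_profiles by (intro member_le_sum) auto
    then show "cmod ((\<lambda>(C, b). \<sigma> m C b) v) \<le> 1" using v norm by simp
  qed
  then obtain h l where h: "strict_mono h"
    and l: "\<And>C b. C \<in> K \<Longrightarrow> b \<in> profiles d C \<Longrightarrow> (\<lambda>m. \<sigma> (h m) C b) \<longlonglongrightarrow> l (C, b)"
    by force
  define \<tau> where "\<tau> C b = l (C, b)" for C b
  have lim: "(\<lambda>m. payoff (X (t (h m))) (\<sigma> (h m)) i r) \<longlonglongrightarrow> payoff X0 \<tau> i r" if r: "r \<in> {1..d i}" for r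
    unfolding payoff_def
  proof (intro tendsto_sum tendsto_mult tendsto_of_real tendsto_prod)
    fix j assume j: "j \<in> slice i"
    then have jJ: "j \<in> J" by (simp add: slice_def)
    have "(i, j(i := r)) \<in> game_coords n d"
      using upd_profile[OF jJ i' r] i' by (simp add: game_coords_def)
    then have "X (t (h m)) (i, j(i := r)) = X0 (i, j(i := r)) + t (h m) * (a (i, j(i := r)) - X0 (i, j(i := r)))" for m
      by (simp add: X_def)
    moreover have "(\<lambda>m. X0 (i, j(i := r)) + t (h m) * (a (i, j(i := r)) - X0 (i, j(i := r))))
        \<longlonglongrightarrow> X0 (i, j(i := r)) + 0 * (a (i, j(i := r)) - X0 (i, j(i := r)))"
      using LIMSEQ_subseq_LIMSEQ[OF t h] by (intro tendsto_intros) (simp add: o_def)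
    ultimately show "(\<lambda>m. X (t (h m)) (i, j(i := r))) \<longlonglongrightarrow> X0 (i, j(i := r))" by simp
    show "(\<lambda>m. \<sigma> (h m) C (restrict j C)) \<longlonglongrightarrow> \<tau> C (restrict j C)" if "C \<in> K - {{i}}" for C
      unfolding \<tau>_def using that restrict_profile[OF jJ] by (intro l) auto
  qed
  have "payoff X0 \<tau> i r = payoff X0 \<tau> i 1" if r: "r \<in> {1..d i}" for r
  proof (rule LIMSEQ_unique[OF lim[OF r]])
    have "1 \<in> {1..d i}" using d_ge_2[OF i'] by simp
    from lim[OF this] show "(\<lambda>m. payoff (X (t (h m))) (\<sigma> (h m)) i r) \<longlonglongrightarrow> payoff X0 \<tau> i 1"
      using sol[OF r] by simp
  qed
  then obtain C where C: "C \<in> K" "\<And>b. b \<in> profiles d C \<Longrightarrow> \<tau> C b = 0" using X0[of \<tau>] by blast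
  have "(\<lambda>m. \<Sum>b\<in>profiles d C. cmod (\<sigma> (h m) C b)) \<longlonglongrightarrow> (\<Sum>b\<in>profiles d C. cmod (\<tau> C b))"
    unfolding \<tau>_def using C(1) by (intro tendsto_intros l)
  then have "(\<Sum>b\<in>profiles d C. cmod (\<tau> C b)) = 1"
    using norm[OF C(1)] by (simp add: LIMSEQ_const_iff)
  then show False using C(2) by simp
qed

section \<open>First-order solutions\<close>

text \<open>Among all admissible assignments take one with the fewest rows assigned into their own block.
  A remaining one could be exchanged with an unused column or another row outside that block.\<close>

lemma ex_assignment:
  fixes R :: "'r set" and Q :: "'q set" and row :: "'r \<Rightarrow> 'k" and col :: "'q \<Rightarrow> 'k"
    and excl :: "'k \<Rightarrow> bool"
  assumes fin: "finite R" "finite Q" and \<iota>: "inj_on \<iota> R" "\<iota> ` R \<subseteq> Q"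
    and card: "\<And>w. w \<in> R \<Longrightarrow> excl (row w) \<Longrightarrow>
      card {w' \<in> R. row w' = row w} \<le> card {q \<in> Q. col q \<noteq> row w}"
  shows "\<exists>f. inj_on f R \<and> f ` R \<subseteq> Q \<and>
    (\<forall>w\<in>R. col (f w) = row w \<longrightarrow> f w = \<iota> w \<and> \<not> excl (row w))"
proof -
  define valid where "valid f \<longleftrightarrow> inj_on f R \<and> f ` R \<subseteq> Q \<and>
    (\<forall>w\<in>R. col (f w) = row w \<longrightarrow> f w = \<iota> w)" for f
  define bad where "bad f = {w \<in> R. excl (row w) \<and> col (f w) = row w}" for f
  have "valid \<iota>" using \<iota> by (simp add: valid_def)
  then obtain f where f: "valid f" and least: "\<And>g. valid g \<Longrightarrow> card (bad f) \<le> card (bad g)"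
    using ex_has_least_nat[of valid \<iota> "\<lambda>f. card (bad f)"] by blast
  have "bad f = {}"
  proof (rule ccontr)
    assume "bad f \<noteq> {}"
    then obtain w where w: "w \<in> R" "excl (row w)" "col (f w) = row w" by (auto simp: bad_def)
    have better: False if "valid g" "bad g \<subseteq> bad f - {w}" for g
    proof -
      have "w \<in> bad f" using w by (simp add: bad_def)
      moreover have "finite (bad f)" using fin by (simp add: bad_def)
      ultimately have "bad g \<subset> bad f" using that(2) by blast
      then have "card (bad g) < card (bad f)" using \<open>finite (bad f)\<close> by (rule psubset_card_mono[rotated])
      then show False using least[OF that(1)] by simp
    qed
    define R1 where "R1 = {w' \<in> R. row w' = row w}"
    define Q1 where "Q1 = {q \<in> Q. col q \<noteq> row w}"
    have "\<not> Q1 \<subseteq> f ` (R1 - {w})"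
    proof
      assume "Q1 \<subseteq> f ` (R1 - {w})"
      then have "card Q1 \<le> card (R1 - {w})"
        using fin by (intro surj_card_le) (auto simp: R1_def)
      also have "\<dots> < card R1" using fin w by (intro card_Diff1_less) (auto simp: R1_def)
      finally show False using card[OF w(1,2)] by (simp add: R1_def Q1_def)
    qed
    then obtain q where q: "q \<in> Q" "col q \<noteq> row w" "q \<notin> f ` (R1 - {w})" by (auto simp: Q1_def)
    have inj: "inj_on f R" and fQ: "f ` R \<subseteq> Q" and own: "\<And>w. w \<in> R \<Longrightarrow> col (f w) = row w \<Longrightarrow> f w = \<iota> w"
      using f by (auto simp: valid_def)
    show False
    proof (cases "q \<in> f ` R")
      case False
      have "valid (f(w := q))"
        using inj fQ own q False by (auto simp: valid_def inj_on_def)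
      moreover have "bad (f(w := q)) \<subseteq> bad f - {w}"
        using q by (auto simp: bad_def)
      ultimately show False by (rule better)
    next
      case True
      then obtain w' where w': "w' \<in> R" "f w' = q" by blast
      then have neq: "w' \<noteq> w" "row w' \<noteq> row w" using q w by (auto simp: R1_def)
      \<comment> \<open>\<open>w'\<close> receives \<open>f w\<close>, a column in the block of
        \<open>w\<close> and hence outside its own block, so the exchange creates no new assignment
        of a row into its own block.\<close>
      let ?g = "f(w := q, w' := f w)"
      have "inj_on ?g R"
        using inj w w' neq unfolding inj_on_def by (metis fun_upd_apply)
      then have "valid ?g"
        using fQ own q w w' neq by (auto simp: valid_def)
      moreover have "bad ?g \<subseteq> bad f - {w}"
        using q w neq by (auto simp: bad_def)
      ultimately show False by (rule better)
    qed
  qed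
  then show ?thesis
    using f by (intro exI[of _ f]) (auto simp: valid_def bad_def)
qed

context player_partition
begin

section \<open>A pivot coordinate for every equation\<close>

definition block where "block i = (THE C. C \<in> K \<and> i \<in> C)"

lemma block_eq: "C \<in> K \<Longrightarrow> i \<in> C \<Longrightarrow> block i = C"
  unfolding block_def by (rule the_block)

lemma block_in:
  assumes "i \<in> {1..n}"
  shows "block i \<in> K \<and> i \<in> block i"
proof -
  obtain C where "C \<in> K" "i \<in> C" using assms Union_K by blast
  then show ?thesis using block_eq by simp
qed

definition unit :: "nat \<Rightarrow> nat \<Rightarrow> nat \<Rightarrow> nat" where
  "unit i r = (\<lambda>k\<in>block i. if k = i then r else 1)"

definition partner :: "nat \<Rightarrow> nat" where
  "partner i = (SOME k. k \<in> block i - {i})"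

text \<open>One element for each equation: strategy \<open>r\<close> of player \<open>i\<close> is
  compared with strategy 1.\<close>

definition rows :: "(nat \<times> nat) set" where
  "rows = (SIGMA i:{1..n}. {2..d i})"

text \<open>One element for each dimension of the product of projective spaces; the coordinate at
  the all-ones profile is the normalized one.\<close>

definition columns :: "(nat set \<times> (nat \<Rightarrow> nat)) set" where
  "columns = (SIGMA C:K. profiles d C - {\<lambda>_\<in>C. 1})"

lemma one_in_profiles: "C \<in> K \<Longrightarrow> (\<lambda>_\<in>C. 1) \<in> profiles d C"
  using d_ge_2 K_subset by (fastforce simp: profiles_def)

lemma unit_profile: "i \<in> {1..n} \<Longrightarrow> r \<in> {1..d i} \<Longrightarrow> unit i r \<in> profiles d (block i)"
  using one_in_profiles block_in[of i] by (auto simp: unit_def profiles_def PiE_iff)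

lemma finite_rows: "finite rows"
  by (auto simp: rows_def)

lemma finite_columns: "finite columns"
  using finite_K finite_profiles by (auto simp: columns_def)

lemma card_columns:
  assumes "K' \<subseteq> K"
  shows "card {q \<in> columns. fst q \<in> K'} = (\<Sum>C\<in>K'. card (profiles d C) - 1)"
proof -
  have "{q \<in> columns. fst q \<in> K'} = (SIGMA C:K'. profiles d C - {\<lambda>_\<in>C. 1})"
    using assms by (auto simp: columns_def)
  also have "card \<dots> = (\<Sum>C\<in>K'. card (profiles d C - {\<lambda>_\<in>C. 1}))"
    using assms finite_K finite_profiles finite_subset by (intro card_SigmaI) auto
  also have "\<dots> = (\<Sum>C\<in>K'. card (profiles d C) - 1)"
    using assms one_in_profiles by (intro sum.cong card_Diff_singleton) auto
  finally show ?thesis .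
qed

text \<open>The default pivot of \<open>(i, r)\<close> is \<open>unit i r\<close> in its own block,
  injective because \<open>r\<close> is at least 2. For an isolated \<open>i\<close> it is
  forbidden, since the payoffs of \<open>i\<close> are compared without the factor of
  \<open>{i}\<close>; then \<open>d i - 1\<close> rows need columns elsewhere, which is what
  \<open>dim\<close> provides.\<close>

lemma ex_pivots:
  assumes dim: "\<And>i. {i} \<in> K \<Longrightarrow> d i - 1 \<le> (\<Sum>C\<in>K - {{i}}. card (profiles d C) - 1)"
  shows "\<exists>f. inj_on f rows \<and> f ` rows \<subseteq> columns \<and>
    (\<forall>i r. (i, r) \<in> rows \<longrightarrow> fst (f (i, r)) = block i \<longrightarrow>
      snd (f (i, r)) = unit i r \<and> block i \<noteq> {i})"
proof -
  have "\<exists>f. inj_on f rows \<and> f ` rows \<subseteq> columns \<and>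
    (\<forall>w\<in>rows. fst (f w) = block (fst w) \<longrightarrow> f w = (block (fst w), unit (fst w) (snd w)) \<and>
      \<not> (\<exists>i. block (fst w) = {i}))"
  proof (rule ex_assignment[where row = "\<lambda>w. block (fst w)" and col = fst
        and \<iota> = "\<lambda>w. (block (fst w), unit (fst w) (snd w))" and excl = "\<lambda>C. \<exists>i. C = {i}"])
    show "inj_on (\<lambda>w. (block (fst w), unit (fst w) (snd w))) rows"
    proof (rule inj_onI)
      fix w w' assume w: "w \<in> rows" "w' \<in> rows"
        and eq: "(block (fst w), unit (fst w) (snd w)) = (block (fst w'), unit (fst w') (snd w'))"
      then have in_block: "fst w \<in> block (fst w)" using block_in by (auto simp: rows_def)
      then have "unit (fst w) (snd w) (fst w) = snd w" by (simp add: unit_def)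
      moreover have "unit (fst w') (snd w') (fst w) = (if fst w = fst w' then snd w' else 1)"
        using in_block eq by (simp add: unit_def)
      ultimately show "w = w'" using eq w by (auto simp: rows_def split: if_splits)
    qed
    show "(\<lambda>w. (block (fst w), unit (fst w) (snd w))) ` rows \<subseteq> columns"
    proof clarify
      fix i r assume ir: "(i, r) \<in> rows"
      then have i: "i \<in> {1..n}" "r \<in> {1..d i}" "r \<noteq> 1" by (auto simp: rows_def)
      have "unit i r i \<noteq> (\<lambda>_\<in>block i. 1) i" using block_in[OF i(1)] i by (simp add: unit_def)
      then have "unit i r \<noteq> (\<lambda>_\<in>block i. 1)" by metis
      then show "(block (fst (i, r)), unit (fst (i, r)) (snd (i, r))) \<in> columns"
        using unit_profile[OF i(1,2)] block_in[OF i(1)] by (simp add: columns_def)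
    qed
    fix w assume w: "w \<in> rows" "\<exists>i. block (fst w) = {i}"
    then obtain i where i: "block (fst w) = {i}" by blast
    have fw: "fst w \<in> {1..n}" using w by (auto simp: rows_def)
    then have iK: "{i} \<in> K" "fst w = i" using i block_in[OF fw] by auto
    have "{w' \<in> rows. block (fst w') = block (fst w)} = {i} \<times> {2..d i}"
      using i iK block_in block_eq[OF iK(1)] K_subset[OF iK(1)]
      by (auto simp: rows_def) (metis atLeastAtMost_iff block_in singletonD)
    then have "card {w' \<in> rows. block (fst w') = block (fst w)} = d i - 1"
      by (simp add: card_cartesian_product)
    also have "\<dots> \<le> card {q \<in> columns. fst q \<in> K - {{i}}}"
      using dim[OF iK(1)] card_columns[of "K - {{i}}"] by simp
    also have "{q \<in> columns. fst q \<in> K - {{i}}} = {q \<in> columns. fst q \<noteq> block (fst w)}"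
      unfolding i columns_def by auto
    finally show "card {w' \<in> rows. block (fst w') = block (fst w)} \<le>
      card {q \<in> columns. fst q \<noteq> block (fst w)}" .
  qed (rule finite_rows finite_columns)+
  then show ?thesis
    by (elim exE conjE, intro exI conjI allI impI) (assumption, assumption, force+)
qed

text \<open>A row with pivot \<open>(C, c)\<close> is realised as the functional \<open>\<tau> C c - \<tau> C e\<close>; the reference
  profile \<open>e\<close> is chosen so that it agrees with \<open>c\<close> at the row's player and is no pivot of a row
  inside its own block, which makes the system triangular.\<close>

lemma partner:
  assumes "i \<in> {1..n}" "block i \<noteq> {i}"
  shows "partner i \<in> block i" "partner i \<noteq> i"
proof -
  have "\<exists>k. k \<in> block i - {i}" using assms block_in[OF assms(1)] by blast
  from someI_ex[OF this] show "partner i \<in> block i" "partner i \<noteq> i"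
    by (auto simp: partner_def)
qed

definition reference :: "nat set \<Rightarrow> nat \<Rightarrow> nat \<Rightarrow> nat \<Rightarrow> nat" where
  "reference C i r = (if C = block i then (unit i r)(partner i := 2) else (\<lambda>_\<in>C. 1))"

lemma reference_profile:
  assumes "(i, r) \<in> rows" "C \<in> K" "C = block i \<longrightarrow> block i \<noteq> {i}"
  shows "reference C i r \<in> profiles d C"
proof (cases "C = block i")
  case True
  have i: "i \<in> {1..n}" "r \<in> {1..d i}" using assms(1) by (auto simp: rows_def)
  have "partner i \<in> block i" using partner[OF i(1)] assms True by simp
  moreover have "2 \<le> d (partner i)"
    using d_ge_2 calculation K_subset[OF assms(2)] True by blast
  ultimately show ?thesis
    using unit_profile[OF i] True by (auto simp: reference_def profiles_def PiE_iff extensional_def)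
next
  case False
  then show ?thesis using one_in_profiles[OF assms(2)] by (simp add: reference_def)
qed

lemma triangular_system:
  fixes v :: "nat \<times> nat \<Rightarrow> complex"
  assumes inj: "inj_on f rows" and cols: "f ` rows \<subseteq> columns"
    and own: "\<And>i r. (i, r) \<in> rows \<Longrightarrow> fst (f (i, r)) = block i \<Longrightarrow>
      snd (f (i, r)) = unit i r \<and> block i \<noteq> {i}"
  shows "\<exists>\<tau>. \<forall>i r. (i, r) \<in> rows \<longrightarrow>
    \<tau> (f (i, r)) - \<tau> (fst (f (i, r)), reference (fst (f (i, r))) i r) = v (i, r)"
proof -
  define Own where "Own = {w \<in> rows. fst (f w) = block (fst w)}"
  define g where "g = the_inv_into rows f"
  have g: "g (f w) = w" if "w \<in> rows" for w
    unfolding g_def using inj that by (rule the_inv_into_f_f)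
  \<comment> \<open>Rows with pivot in another block come first: their reference is the all-ones
    profile, which is no column and gets value 0. Rows with pivot in their own block are then
    corrected by the value already fixed at their reference.\<close>
  define \<tau>0 where "\<tau>0 q = (if q \<in> f ` (rows - Own) then v (g q) else 0)" for q
  define \<tau> where "\<tau> q = (if q \<in> f ` Own then v (g q) +
    \<tau>0 (fst q, reference (fst q) (fst (g q)) (snd (g q))) else \<tau>0 q)" for q
  have Own: "Own \<subseteq> rows" by (auto simp: Own_def)
  have main: "\<tau> (f (i, r)) - \<tau> (fst (f (i, r)), reference (fst (f (i, r))) i r) = v (i, r)"
    if ir: "(i, r) \<in> rows" for i r
  proof (cases "(i, r) \<in> Own")
    case True
    then have C: "fst (f (i, r)) = block i" by (simp add: Own_def)
    have i: "i \<in> {1..n}" "2 \<le> r" using ir by (auto simp: rows_def)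
    have part: "partner i \<in> block i" "partner i \<noteq> i"
      using partner[OF i(1)] own[OF ir C] by auto
    \<comment> \<open>The reference differs from the all-ones profile at both \<open>i\<close> and
      \<open>partner i\<close>, whereas a pivot inside its own block is some
      \<open>unit i' r'\<close> and differs at one player.\<close>
    have "(block i, reference (block i) i r) \<notin> f ` Own"
    proof
      assume "(block i, reference (block i) i r) \<in> f ` Own"
      then obtain i' r' where w: "(i', r') \<in> Own" "f (i', r') = (block i, reference (block i) i r)" by force
      then have "block i' = block i" "unit i' r' = (unit i r)(partner i := 2)"
        using own[of i' r'] by (auto simp: Own_def reference_def)
      then have "unit i' r' i = r" "unit i' r' (partner i) = 2"
        using block_in[OF i(1)] part by (auto simp: unit_def)
      moreover have "unit i' r' k = (if k = i' then r' else 1)" if "k \<in> block i" for k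
        using that \<open>block i' = block i\<close> by (simp add: unit_def)
      ultimately have "i = i'" "partner i = i'"
        using part(1) i block_in[OF i(1)] by (fastforce split: if_splits)+
      then show False using part(2) by simp
    qed
    then have "\<tau> (block i, reference (block i) i r) = \<tau>0 (block i, reference (block i) i r)"
      by (simp add: \<tau>_def)
    moreover have "\<tau> (f (i, r)) = v (i, r) + \<tau>0 (block i, reference (block i) i r)"
      using True g[OF ir] C by (auto simp: \<tau>_def)
    ultimately show ?thesis using C by simp
  next
    case False
    then have ref: "reference (fst (f (i, r))) i r = (\<lambda>_\<in>fst (f (i, r)). 1)"
      using ir by (simp add: Own_def reference_def)
    have "(fst (f (i, r)), \<lambda>_\<in>fst (f (i, r)). 1) \<notin> f ` rows"
      using cols by (auto simp: columns_def)
    then have "\<tau> (fst (f (i, r)), reference (fst (f (i, r))) i r) = 0"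
      unfolding ref \<tau>_def \<tau>0_def using Own by auto
    moreover have "f (i, r) \<notin> f ` Own"
      using inj_on_image_mem_iff[OF inj ir Own] False by simp
    then have "\<tau> (f (i, r)) = v (i, r)"
      using False ir g[OF ir] by (simp add: \<tau>_def \<tau>0_def)
    ultimately show ?thesis by simp
  qed
  then show ?thesis by blast
qed

section \<open>The base game and its first-order equations\<close>

definition place :: "nat set \<Rightarrow> (nat \<Rightarrow> nat) \<Rightarrow> nat \<Rightarrow> nat \<Rightarrow> nat \<Rightarrow> nat" where
  "place C b i r = (\<lambda>k\<in>{1..n}. if k \<in> C then b k else if k = i then r else 1)"

lemma place_profile:
  assumes "C \<in> K" "b \<in> profiles d C" "r \<in> {1..d i}"
  shows "place C b i r \<in> J"
proof -
  have "place C b i r k \<in> {1..d k}" if "k \<in> {1..n}" for k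
    using assms that d_ge_2[OF that] by (auto simp: place_def profiles_def PiE_iff)
  then show ?thesis by (auto simp: profiles_def place_def)
qed

lemma restrict_place:
  assumes "C \<in> K" "b \<in> profiles d C"
  shows "restrict (place C b i r) C = b"
proof
  fix k show "restrict (place C b i r) C k = b k"
    using assms K_subset[OF assms(1)]
    by (cases "k \<in> C") (auto simp: place_def profiles_def PiE_iff extensional_def)
qed

text \<open>Both placements agree outside \<open>C\<close>, so the other blocks cancel. Thus payoffs
  1 and -1 at two profiles realize a single difference of coordinates.\<close>

lemma sum_blocks_place_diff:
  fixes \<tau> :: "nat set \<Rightarrow> (nat \<Rightarrow> nat) \<Rightarrow> complex"
  assumes "C \<in> K" "c \<in> profiles d C" "e \<in> profiles d C"
  shows "(\<Sum>C'\<in>K. \<tau> C' (restrict (place C c i r) C')) - (\<Sum>C'\<in>K. \<tau> C' (restrict (place C e i r) C')) =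
    \<tau> C c - \<tau> C e"
proof -
  have "restrict (place C c i r) C' = restrict (place C e i r) C'" if "C' \<in> K - {C}" for C'
    using K_disjoint[OF assms(1), of C'] that by (auto simp: place_def fun_eq_iff)
  then show ?thesis
    using restrict_place[OF assms(1,2)] restrict_place[OF assms(1,3)]
    by (simp add: sum.remove[OF finite_K assms(1)])
qed

text \<open>The payoffs of \<open>X0\<close> sum to 0 in every slice, so parameters equal to 1 solve
  it. To first order, the payoff sums must change at a rate \<open>\<mu> i\<close> per profile, the
  same for all strategies of \<open>i\<close>; these conditions become the pivot differences solved
  by \<open>triangular_system\<close>.\<close>

lemma tangent:
  assumes dim: "\<And>i. {i} \<in> K \<Longrightarrow> d i - 1 \<le> (\<Sum>C\<in>K - {{i}}. card (profiles d C) - 1)"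
  shows "\<exists>X0 :: nat \<times> (nat \<Rightarrow> nat) \<Rightarrow> complex. \<forall>Z. \<exists>\<tau> \<mu>. \<forall>i\<in>{1..n}. \<forall>r\<in>{1..d i}.
    (\<Sum>j\<in>{j \<in> J. j i = r}. X0 (i, j)) = 0 \<and>
    (\<Sum>j\<in>{j \<in> J. j i = r}. X0 (i, j) * (\<Sum>C\<in>K. \<tau> C (restrict j C)) + Z (i, j) - \<mu> i) = 0"
proof -
  obtain f where f: "inj_on f rows" "f ` rows \<subseteq> columns"
    and own: "\<And>i r. (i, r) \<in> rows \<Longrightarrow> fst (f (i, r)) = block i \<Longrightarrow>
      snd (f (i, r)) = unit i r \<and> block i \<noteq> {i}"
    using ex_pivots[OF dim] by blast
  define pos where "pos i r = place (fst (f (i, r))) (snd (f (i, r))) i r" for i r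
  define neg where "neg i r = place (fst (f (i, r))) (reference (fst (f (i, r))) i r) i r" for i r
  \<comment> \<open>Both special profiles of row \<open>(i, r)\<close> have \<open>i\<close> playing
    \<open>r\<close>, so they fall into the same slice. Strategy 1 gets payoff 0 throughout and is
    the one the others are compared with.\<close>
  define X0 :: "nat \<times> (nat \<Rightarrow> nat) \<Rightarrow> complex" where
    "X0 = (\<lambda>(i, j). if 2 \<le> j i then (if j = pos i (j i) then 1 else 0) - (if j = neg i (j i) then 1 else 0) else 0)"
  have fir: "fst (f (i, r)) \<in> K" "snd (f (i, r)) \<in> profiles d (fst (f (i, r)))"
    "reference (fst (f (i, r))) i r \<in> profiles d (fst (f (i, r)))"
    if "(i, r) \<in> rows" for i r
  proof -
    have "f (i, r) \<in> columns" using f(2) that by blast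
    then show C: "fst (f (i, r)) \<in> K" and "snd (f (i, r)) \<in> profiles d (fst (f (i, r)))"
      by (auto simp: columns_def)
    show "reference (fst (f (i, r))) i r \<in> profiles d (fst (f (i, r)))"
      using reference_profile[OF that C] own[OF that] by simp
  qed
  have at_i: "pos i r i = r" "neg i r i = r" if ir: "(i, r) \<in> rows" for i r
  proof -
    have i: "i \<in> {1..n}" using ir by (auto simp: rows_def)
    show "pos i r i = r"
      using block_eq[OF fir(1)[OF ir], of i] own[OF ir] i by (auto simp: pos_def place_def unit_def)
    show "neg i r i = r"
      using block_eq[OF fir(1)[OF ir], of i] own[OF ir] i partner[OF i]
      by (auto simp: neg_def place_def reference_def unit_def)
  qed
  have in_J: "pos i r \<in> J" "neg i r \<in> J" if ir: "(i, r) \<in> rows" for i r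
  proof -
    have "r \<in> {1..d i}" using ir by (auto simp: rows_def)
    then show "pos i r \<in> J" "neg i r \<in> J"
      unfolding pos_def neg_def using fir[OF ir] by (blast intro: place_profile)+
  qed
  have slice_sum: "(\<Sum>j\<in>{j \<in> J. j i = r}. X0 (i, j) * g j) = (if r = 1 then 0 else g (pos i r) - g (neg i r))"
    if i: "i \<in> {1..n}" "r \<in> {1..d i}" for i r and g :: "(nat \<Rightarrow> nat) \<Rightarrow> complex"
  proof (cases "r = 1")
    case True
    then show ?thesis by (auto simp: X0_def intro!: sum.neutral)
  next
    case False
    then have r: "(i, r) \<in> rows" using i by (auto simp: rows_def)
    have fin: "finite {j \<in> J. j i = r}" using finite_J by simp
    have "(\<Sum>j\<in>{j \<in> J. j i = r}. X0 (i, j) * g j) =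
        (\<Sum>j\<in>{j \<in> J. j i = r}. (if j = pos i r then g j else 0) - (if j = neg i r then g j else 0))"
      using False i by (intro sum.cong) (auto simp: X0_def)
    also have "\<dots> = g (pos i r) - g (neg i r)"
      using in_J[OF r] at_i[OF r] fin by (simp add: sum_subtractf)
    finally show ?thesis using False by simp
  qed
  show ?thesis
  proof (intro exI[of _ X0] allI)
    fix Z :: "nat \<times> (nat \<Rightarrow> nat) \<Rightarrow> complex"
    define \<zeta> where "\<zeta> i r = (\<Sum>j\<in>{j \<in> J. j i = r}. Z (i, j))" for i r
    obtain \<tau> where \<tau>: "\<And>i r. (i, r) \<in> rows \<Longrightarrow>
      \<tau> (f (i, r)) - \<tau> (fst (f (i, r)), reference (fst (f (i, r))) i r) = \<zeta> i 1 - \<zeta> i r"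
      using triangular_system[OF f own, of "\<lambda>(i, r). \<zeta> i 1 - \<zeta> i r"] by auto
    define \<tau>' where "\<tau>' C b = \<tau> (C, b)" for C b
    \<comment> \<open>The equation of strategy 1 involves no parameter direction and determines
      \<open>\<mu> i\<close>; the same value serves the other strategies because all slices of
      \<open>i\<close> have equal size.\<close>
    define \<mu> where "\<mu> i = \<zeta> i 1 / of_nat (card (slice i))" for i
    have "(\<Sum>j\<in>{j \<in> J. j i = r}. X0 (i, j)) = 0 \<and>
      (\<Sum>j\<in>{j \<in> J. j i = r}. X0 (i, j) * (\<Sum>C\<in>K. \<tau>' C (restrict j C)) + Z (i, j) - \<mu> i) = 0"
      if i: "i \<in> {1..n}" "r \<in> {1..d i}" for i r
    proof
      show "(\<Sum>j\<in>{j \<in> J. j i = r}. X0 (i, j)) = 0" using slice_sum[OF i, of "\<lambda>_. 1"] by simp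
      have "(\<lambda>k\<in>{1..n}. 1) \<in> slice i" using one_profile i by (simp add: slice_def)
      then have "card (slice i) \<noteq> 0" using finite_J by (auto simp: slice_def)
      moreover have "card {j \<in> J. j i = r} = card (slice i)"
        using slice_reindex[OF i, of "\<lambda>_. 1::nat"] by simp
      ultimately have \<mu>: "(\<Sum>j\<in>{j \<in> J. j i = r}. \<mu> i) = \<zeta> i 1" by (simp add: \<mu>_def)
      have "(\<Sum>j\<in>{j \<in> J. j i = r}. X0 (i, j) * (\<Sum>C\<in>K. \<tau>' C (restrict j C))) = \<zeta> i 1 - \<zeta> i r"
      proof (cases "r = 1")
        case True
        then show ?thesis unfolding slice_sum[OF i] by simp
      next
        case False
        then have r: "(i, r) \<in> rows" using i by (auto simp: rows_def)
        have "(\<Sum>j\<in>{j \<in> J. j i = r}. X0 (i, j) * (\<Sum>C\<in>K. \<tau>' C (restrict j C))) =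
            \<tau>' (fst (f (i, r))) (snd (f (i, r))) - \<tau>' (fst (f (i, r))) (reference (fst (f (i, r))) i r)"
          unfolding slice_sum[OF i] using False sum_blocks_place_diff[OF fir[OF r]]
          by (simp add: pos_def neg_def)
        then show ?thesis using \<tau>[OF r] by (simp add: \<tau>'_def)
      qed
      then show "(\<Sum>j\<in>{j \<in> J. j i = r}. X0 (i, j) * (\<Sum>C\<in>K. \<tau>' C (restrict j C)) + Z (i, j) - \<mu> i) = 0"
        using \<mu> by (simp add: sum.distrib sum_subtractf \<zeta>_def)
    qed
    then show "\<exists>\<tau> \<mu>. \<forall>i\<in>{1..n}. \<forall>r\<in>{1..d i}.
      (\<Sum>j\<in>{j \<in> J. j i = r}. X0 (i, j)) = 0 \<and>
      (\<Sum>j\<in>{j \<in> J. j i = r}. X0 (i, j) * (\<Sum>C\<in>K. \<tau> C (restrict j C)) + Z (i, j) - \<mu> i) = 0"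
      by blast
  qed
qed

end

section \<open>Games with solutions\<close>

lemma poly_fun_compose:
  assumes "f \<in> poly_fun W" "\<And>w. w \<in> W \<Longrightarrow> (\<lambda>x. T x w) \<in> poly_fun V"
  shows "(\<lambda>x. f (T x)) \<in> poly_fun V"
  using assms by induction (auto intro: poly_fun_const poly_fun_add poly_fun_mult)

context player_partition
begin

text \<open>Allows complex payoffs, since elimination needs an algebraically closed field; real
  games come back in \<open>solves_nonempty\<close>.\<close>

definition row_at :: "(nat \<times> (nat \<Rightarrow> nat) \<Rightarrow> complex) \<Rightarrow> ((nat \<Rightarrow> nat) \<Rightarrow> complex) \<Rightarrow> nat \<Rightarrow> nat \<Rightarrow> complex \<times> complex" where
  "row_at x p i r = (\<Sum>j\<in>{j \<in> J. j i = r}. p j, \<Sum>j\<in>{j \<in> J. j i = r}. x (i, j) * p j)"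

definition solves :: "(nat \<times> (nat \<Rightarrow> nat) \<Rightarrow> complex) \<Rightarrow> (nat set \<Rightarrow> (nat \<Rightarrow> nat) \<Rightarrow> complex) \<Rightarrow> bool" where
  "solves x \<sigma> \<longleftrightarrow> (\<forall>j\<in>J. blocks \<sigma> j \<noteq> 0) \<and> (\<Sum>j\<in>J. blocks \<sigma> j) \<noteq> 0 \<and>
    (\<forall>i\<in>{1..n}. \<forall>r\<in>{1..d i}. \<forall>s\<in>{1..d i}. minor2 (row_at x (blocks \<sigma>) i r) (row_at x (blocks \<sigma>) i s) = 0)"

lemma solves_nonempty:
  assumes K: "K = max_cliques G" and "solves (\<lambda>v. complex_of_real (X v)) \<sigma>"
  shows "spohn_CI_variety n d X G \<noteq> {}"
proof (rule spohn_CI_nonemptyI)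
  let ?p = "restrict (clique_product G \<sigma>) J"
  have p: "clique_product G \<sigma> j = blocks \<sigma> j" for j
    by (simp add: blocks_def flip: K)
  show "J \<noteq> {}" using one_profile by blast
  show "?p = ?p" ..
  show "?p j \<noteq> 0" if "j \<in> J" for j
    using assms(2) that p by (simp add: solves_def)
  show "(\<Sum>j\<in>J. ?p j) \<noteq> 0"
    using assms(2) p by (simp add: solves_def)
  fix i r s assume irs: "i \<in> {1..n}" "r \<in> {1..d i}" "s \<in> {1..d i}"
  have "spohn_row n d X ?p i r = row_at (\<lambda>v. complex_of_real (X v)) (blocks \<sigma>) i r" for r
    unfolding spohn_row_def row_at_def by (auto simp: p intro!: sum.cong)
  then show "minor2 (spohn_row n d X ?p i r) (spohn_row n d X ?p i s) = 0"
    using assms(2) irs by (simp add: solves_def)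
qed

text \<open>Product rule at 0: every factor is 1 there, so the derivative is the sum of the
  directions.\<close>

lemma blocks_tendsto:
  fixes \<tau> :: "nat set \<Rightarrow> (nat \<Rightarrow> nat) \<Rightarrow> complex"
  defines "p \<equiv> \<lambda>e. blocks (\<lambda>C b. 1 + e * \<tau> C b)"
  shows "((\<lambda>e. p e j) \<longlongrightarrow> 1) (at 0)"
    and "((\<lambda>e. (p e j - 1) / e) \<longlongrightarrow> (\<Sum>C\<in>K. \<tau> C (restrict j C))) (at 0)"
proof -
  have "((\<lambda>e. p e j) \<longlongrightarrow> (\<Prod>C\<in>K. 1 + 0 * \<tau> C (restrict j C))) (at 0)"
    unfolding p_def blocks_def by (intro tendsto_intros)
  then show "((\<lambda>e. p e j) \<longlongrightarrow> 1) (at 0)" by simp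
  have "((\<lambda>e. \<Prod>C\<in>K. 1 + e * \<tau> C (restrict j C)) has_derivative
      (\<lambda>y. \<Sum>C\<in>K. y * \<tau> C (restrict j C) * (\<Prod>C'\<in>K - {C}. 1 + 0 * \<tau> C' (restrict j C')))) (at 0)"
    by (rule has_derivative_prod) (auto intro!: derivative_eq_intros)
  then have "((\<lambda>e. p e j) has_field_derivative (\<Sum>C\<in>K. \<tau> C (restrict j C))) (at 0)"
    unfolding has_field_derivative_def p_def blocks_def
    by (rule has_derivative_eq_rhs) (simp add: fun_eq_iff sum_distrib_left mult.commute)
  then show "((\<lambda>e. (p e j - 1) / e) \<longlongrightarrow> (\<Sum>C\<in>K. \<tau> C (restrict j C))) (at 0)"
    by (simp add: DERIV_def p_def blocks_def)
qed

text \<open>Moving \<open>\<sigma>\<close> from \<open>1\<close> in the direction \<open>\<tau>\<close> and the game from \<open>X0\<close> in the direction \<open>Z\<close>, the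
  equations hold to first order by \<open>tangent\<close>; since they are linear in the game they are restored by
  a correction of the game of smaller order.\<close>

lemma ex_solution_path:
  assumes tan: "\<forall>i\<in>{1..n}. \<forall>r\<in>{1..d i}. (\<Sum>j\<in>{j \<in> J. j i = r}. X0 (i, j)) = 0 \<and>
    (\<Sum>j\<in>{j \<in> J. j i = r}. X0 (i, j) * (\<Sum>C\<in>K. \<tau> C (restrict j C)) + Z (i, j) - \<mu> i) = 0"
  shows "\<exists>z. (\<forall>v\<in>game_coords n d. ((\<lambda>e. z e v) \<longlongrightarrow> Z v) (at 0)) \<and>
    (\<forall>\<^sub>F e in at 0. \<exists>\<sigma>. solves (\<lambda>v. X0 v + e * z e v) \<sigma>)"
proof -
  define p where "p e = blocks (\<lambda>C b. 1 + e * \<tau> C b)" for e :: complex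
  define A where "A i r e = (\<Sum>j\<in>{j \<in> J. j i = r}. p e j)" for i r e
  \<comment> \<open>\<open>\<rho> i r e\<close> is the defect of the row from having ratio
    \<open>e * \<mu> i\<close>. Subtracting the constant \<open>\<rho> / A\<close> from the payoffs
    of the slice changes its weighted sum by exactly this defect, so all rows of \<open>i\<close>
    become proportional.\<close>
  define \<rho> where "\<rho> i r e = (\<Sum>j\<in>{j \<in> J. j i = r}. (X0 (i, j) + e * Z (i, j) - e * \<mu> i) * p e j)" for i r e
  define z where "z e = (\<lambda>(i, j). Z (i, j) - (\<rho> i (j i) e / e) / A i (j i) e)" for e
  have p1: "((\<lambda>e. p e j) \<longlongrightarrow> 1) (at 0)" for j
    unfolding p_def by (rule blocks_tendsto)
  have p_nz: "\<forall>\<^sub>F e in at 0. p e j \<noteq> 0" for j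
    using p1[of j] by (rule tendsto_imp_eventually_ne) simp
  have sum_lim: "((\<lambda>e. \<Sum>j\<in>I. p e j) \<longlongrightarrow> of_nat (card I)) (at 0)" for I
    using tendsto_sum[of I "\<lambda>j e. p e j" "\<lambda>j. 1" "at 0"] p1 by simp
  have sum_nz: "\<forall>\<^sub>F e in at 0. (\<Sum>j\<in>I. p e j) \<noteq> 0" if "finite I" "I \<noteq> {}" for I
    using sum_lim[of I] by (rule tendsto_imp_eventually_ne) (use that in simp)
  have slice_ne: "{j \<in> J. j i = r} \<noteq> {}" if "i \<in> {1..n}" "r \<in> {1..d i}" for i r
    using upd_profile[OF one_profile that] by (metis (mono_tags, lifting) empty_Collect_eq fun_upd_same)
  have A_lim: "(A i r \<longlongrightarrow> of_nat (card {j \<in> J. j i = r})) (at 0)" for i r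
    unfolding A_def by (rule sum_lim)
  have A_nz: "\<forall>\<^sub>F e in at 0. A i r e \<noteq> 0" if "i \<in> {1..n}" "r \<in> {1..d i}" for i r
    unfolding A_def using finite_J slice_ne[OF that] by (intro sum_nz) auto
  \<comment> \<open>The defect vanishes at \<open>e = 0\<close> because the slice sums of
    \<open>X0\<close> are 0; its derivative there is the linear expression that \<open>tan\<close>
    makes 0.\<close>
  have \<rho>_lim: "((\<lambda>e. \<rho> i r e / e) \<longlongrightarrow> 0) (at 0)" if i: "i \<in> {1..n}" "r \<in> {1..d i}" for i r
  proof -
    let ?I = "{j \<in> J. j i = r}"
    have "((\<lambda>e. \<Sum>j\<in>?I. X0 (i, j) * ((p e j - 1) / e) + (Z (i, j) - \<mu> i) * p e j) \<longlongrightarrow>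
        (\<Sum>j\<in>?I. X0 (i, j) * (\<Sum>C\<in>K. \<tau> C (restrict j C)) + (Z (i, j) - \<mu> i) * 1)) (at 0)"
      unfolding p_def by (intro tendsto_intros blocks_tendsto)
    moreover have "(\<Sum>j\<in>?I. X0 (i, j) * (\<Sum>C\<in>K. \<tau> C (restrict j C)) + (Z (i, j) - \<mu> i) * 1) = 0"
      using tan i by (simp add: add_diff_eq)
    moreover have "\<forall>\<^sub>F e in at 0. (\<Sum>j\<in>?I. X0 (i, j) * ((p e j - 1) / e) + (Z (i, j) - \<mu> i) * p e j) = \<rho> i r e / e"
      using eventually_neq_at_within[of 0 0 UNIV]
    proof eventually_elim
      case (elim e)
      have "(\<Sum>j\<in>?I. X0 (i, j) * ((p e j - 1) / e) + (Z (i, j) - \<mu> i) * p e j) =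
          (\<Sum>j\<in>?I. (X0 (i, j) + e * Z (i, j) - e * \<mu> i) * p e j / e - X0 (i, j) / e)"
        using elim by (intro sum.cong) (simp_all add: field_simps)
      also have "\<dots> = \<rho> i r e / e - (\<Sum>j\<in>?I. X0 (i, j)) / e"
        by (simp add: sum_subtractf \<rho>_def sum_divide_distrib)
      finally show ?case using tan i by simp
    qed
    ultimately show ?thesis using Lim_transform_eventually by fastforce
  qed
  have z_lim: "((\<lambda>e. z e v) \<longlongrightarrow> Z v) (at 0)" if v_in: "v \<in> game_coords n d" for v
  proof -
    obtain i j where v: "v = (i, j)" "i \<in> {1..n}" "j \<in> J" using v_in by (auto simp: game_coords_def)
    then have ji: "j i \<in> {1..d i}" by (auto simp: profiles_def PiE_iff)
    have "((\<lambda>e. Z (i, j) - (\<rho> i (j i) e / e) / A i (j i) e) \<longlongrightarrow>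
        Z (i, j) - 0 / of_nat (card {j' \<in> J. j' i = j i})) (at 0)"
      using finite_J v by (intro tendsto_intros \<rho>_lim A_lim ji) auto
    then show ?thesis by (simp add: z_def v)
  qed
  have "\<forall>\<^sub>F e in at 0. (\<forall>i\<in>{1..n}. \<forall>r\<in>{1..d i}. A i r e \<noteq> 0)"
    using A_nz by (simp add: eventually_ball_finite)
  moreover have "\<forall>\<^sub>F e in at 0. \<forall>j\<in>J. p e j \<noteq> 0"
    using p_nz finite_J by (simp add: eventually_ball_finite)
  moreover have "\<forall>\<^sub>F e in at 0. (\<Sum>j\<in>J. p e j) \<noteq> 0"
    using sum_nz[OF finite_J] one_profile by blast
  moreover have "\<forall>\<^sub>F e in at (0::complex). e \<noteq> 0"
    by (rule eventually_neq_at_within)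
  ultimately have "\<forall>\<^sub>F e in at 0. \<exists>\<sigma>. solves (\<lambda>v. X0 v + e * z e v) \<sigma>"
  proof eventually_elim
    case (elim e)
    have row: "row_at (\<lambda>v. X0 v + e * z e v) (p e) i r = (A i r e, e * \<mu> i * A i r e)"
      if i: "i \<in> {1..n}" "r \<in> {1..d i}" for i r
    proof -
      let ?I = "{j \<in> J. j i = r}"
      have A: "A i r e \<noteq> 0" using elim(1) i by blast
      have "(\<Sum>j\<in>?I. (X0 (i, j) + e * z e (i, j)) * p e j) =
          (\<Sum>j\<in>?I. (X0 (i, j) + e * Z (i, j) - e * \<mu> i) * p e j + e * \<mu> i * p e j - \<rho> i r e / A i r e * p e j)"
        using elim(4) by (intro sum.cong) (auto simp: z_def algebra_simps)
      also have "\<dots> = \<rho> i r e + e * \<mu> i * A i r e - \<rho> i r e / A i r e * A i r e"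
        by (simp add: sum.distrib sum_subtractf \<rho>_def A_def sum_distrib_left)
      also have "\<dots> = e * \<mu> i * A i r e" using A by simp
      finally show ?thesis by (simp add: row_at_def A_def)
    qed
    have "solves (\<lambda>v. X0 v + e * z e v) (\<lambda>C b. 1 + e * \<tau> C b)"
      unfolding solves_def p_def[symmetric]
      using elim(2,3) row by (simp add: minor2_def)
    then show ?case by blast
  qed
  then show ?thesis using z_lim by blast
qed

lemma generically_nonempty:
  assumes K: "K = max_cliques G"
    and dim: "\<And>i. {i} \<in> K \<Longrightarrow> d i - 1 \<le> (\<Sum>C\<in>K - {{i}}. card (profiles d C) - 1)"
  shows "holds_generically (game_coords n d) (\<lambda>X. spohn_CI_variety n d X G \<noteq> {})"
proof -
  \<comment> \<open>A sum type joins payoffs (\<open>Inl\<close>) and parameters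
    (\<open>Inr\<close>), so that projecting to the games means eliminating the finitely many
    coordinates in \<open>U\<close>.\<close>
  define V :: "((nat \<times> (nat \<Rightarrow> nat)) + (nat set \<times> (nat \<Rightarrow> nat))) set"
    where "V = Inl ` game_coords n d"
  define U :: "((nat \<times> (nat \<Rightarrow> nat)) + (nat set \<times> (nat \<Rightarrow> nat))) set"
    where "U = Inr ` Sigma K (profiles d)"
  define sol where "sol y \<longleftrightarrow> solves (\<lambda>v. y (Inl v)) (\<lambda>C b. y (Inr (C, b)))" for y
  have blk: "(\<lambda>y. blocks (\<lambda>C b. y (Inr (C, b))) j) \<in> poly_fun (U \<union> V)" if "j \<in> J" for j
    unfolding blocks_def using restrict_profile[OF that]
    by (intro poly_fun_prod poly_fun_var) (auto simp: U_def)
  have coord: "(\<lambda>y. y (Inl (i, j))) \<in> poly_fun (U \<union> V)" if "i \<in> {1..n}" "j \<in> J" for i j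
    using that by (intro poly_fun_var) (simp add: V_def game_coords_def)
  have "sol \<in> constructible (U \<union> V)"
    unfolding sol_def solves_def minor2_def row_at_def fst_conv snd_conv
    by (intro constructible_conj constructible_ball constructible_not constructible_eq poly_fun_diff poly_fun_mult poly_fun_sum blk coord
        finite_J finite_atLeastAtMost) auto
  moreover have "finite U" using finite_K finite_profiles by (auto simp: U_def)
  ultimately have "(\<lambda>x. \<exists>u. sol (\<lambda>v. if v \<in> U then u v else x v)) \<in> constructible V"
    by (intro constructible_ex_finite)
  from constructible_dichotomy[OF this] obtain g y where g: "g \<in> poly_fun V" "g y \<noteq> 0"
    and dich: "(\<forall>x. g x \<noteq> 0 \<longrightarrow> (\<exists>u. sol (\<lambda>v. if v \<in> U then u v else x v))) \<or>
      (\<forall>x. g x \<noteq> 0 \<longrightarrow> \<not> (\<exists>u. sol (\<lambda>v. if v \<in> U then u v else x v)))"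
    by blast
  obtain X0 where X0: "\<And>Z. \<exists>\<tau> \<mu>. \<forall>i\<in>{1..n}. \<forall>r\<in>{1..d i}.
    (\<Sum>j\<in>{j \<in> J. j i = r}. X0 (i, j)) = 0 \<and>
    (\<Sum>j\<in>{j \<in> J. j i = r}. X0 (i, j) * (\<Sum>C\<in>K. \<tau> C (restrict j C)) + Z (i, j) - \<mu> i) = (0::complex)"
    using tangent[OF dim] by blast
  \<comment> \<open>This rules out the second alternative of \<open>dich\<close>, leaving
    solvability of every complex game where \<open>g\<close> is nonzero.\<close>
  have "\<exists>x\<in>{x. \<exists>u. sol (\<lambda>v. if v \<in> U then u v else x v)}. g x \<noteq> 0"
  proof (rule poly_fun_not_vanish[OF g, where a = "case_sum X0 (\<lambda>_. 0)"])
    fix Z :: "(nat \<times> (nat \<Rightarrow> nat)) + (nat set \<times> (nat \<Rightarrow> nat)) \<Rightarrow> complex"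
    obtain \<tau> \<mu> where "\<forall>i\<in>{1..n}. \<forall>r\<in>{1..d i}.
      (\<Sum>j\<in>{j \<in> J. j i = r}. X0 (i, j)) = 0 \<and>
      (\<Sum>j\<in>{j \<in> J. j i = r}. X0 (i, j) * (\<Sum>C\<in>K. \<tau> C (restrict j C)) + (Z \<circ> Inl) (i, j) - \<mu> i) = 0"
      using X0[of "Z \<circ> Inl"] by blast
    from ex_solution_path[OF this] obtain z where
      z: "\<And>v. v \<in> game_coords n d \<Longrightarrow> ((\<lambda>e. z e v) \<longlongrightarrow> (Z \<circ> Inl) v) (at 0)"
        "\<forall>\<^sub>F e in at 0. \<exists>\<sigma>. solves (\<lambda>v. X0 v + e * z e v) \<sigma>" by blast
    have "\<forall>\<^sub>F e in at 0. (\<lambda>v. case_sum X0 (\<lambda>_. 0) v + e * case_sum (z e) (\<lambda>_. 0) v) \<in>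
        {x. \<exists>u. sol (\<lambda>v. if v \<in> U then u v else x v)}"
      using z(2)
    proof eventually_elim
      case (elim e)
      then obtain \<sigma> where \<sigma>: "solves (\<lambda>v. X0 v + e * z e v) \<sigma>" by blast
      define u :: "(nat \<times> (nat \<Rightarrow> nat)) + (nat set \<times> (nat \<Rightarrow> nat)) \<Rightarrow> complex"
        where "u = case_sum (\<lambda>_. 0) (\<lambda>(C, b). \<sigma> C b)"
      let ?x = "\<lambda>v. case_sum X0 (\<lambda>_. 0) v + e * case_sum (z e) (\<lambda>_. 0) v"
      let ?y = "\<lambda>v. if v \<in> U then u v else ?x v"
      have "blocks (\<lambda>C b. ?y (Inr (C, b))) j = blocks \<sigma> j" if "j \<in> J" for j
        unfolding blocks_def using restrict_profile[OF that]
        by (intro prod.cong) (auto simp: U_def u_def)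
      moreover have "?y (Inl v) = X0 v + e * z e v" for v by (auto simp: U_def)
      ultimately have "sol ?y"
        using \<sigma> by (simp add: sol_def solves_def row_at_def)
      then show ?case by blast
    qed
    moreover have "((\<lambda>e. case_sum (z e) (\<lambda>_. 0) v) \<longlongrightarrow> Z v) (at 0)" if "v \<in> V" for v
      using that z(1) by (auto simp: V_def)
    ultimately show "\<exists>z. (\<forall>v\<in>V. ((\<lambda>e. z e v) \<longlongrightarrow> Z v) (at 0)) \<and>
      (\<forall>\<^sub>F e in at 0. (\<lambda>v. case_sum X0 (\<lambda>_. 0) v + e * z e v) \<in> {x. \<exists>u. sol (\<lambda>v. if v \<in> U then u v else x v)})"
      by (intro exI[of _ "\<lambda>e. case_sum (z e) (\<lambda>_. 0)"]) blast
  qed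
  then have gen: "\<exists>u. sol (\<lambda>v. if v \<in> U then u v else x v)" if "g x \<noteq> 0" for x
    using dich that by blast
  obtain x where x: "g (\<lambda>v. complex_of_real (x v)) \<noteq> 0" using poly_fun_real_point[OF g] by blast
  obtain p q where pq: "p \<in> poly_fun V" "q \<in> poly_fun V" "\<And>x. g (\<lambda>v. complex_of_real (x v)) = Complex (p x) (q x)"
    using poly_fun_Re_Im[OF g(1)] by blast
  have ext: "(\<lambda>X. f (case_sum X (\<lambda>_. 0))) \<in> poly_fun (game_coords n d)" if "f \<in> poly_fun V" for f :: "_ \<Rightarrow> real"
    using that by (rule poly_fun_compose) (auto simp: V_def intro: poly_fun_var)
  have val: "f (case_sum (\<lambda>c. x (Inl c)) (\<lambda>_. 0)) = f x" if "f \<in> poly_fun V" for f :: "_ \<Rightarrow> real"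
    using that by (rule poly_fun_cong) (auto simp: V_def)
  show ?thesis
  proof (rule holds_genericallyI[where F = "{\<lambda>X. p (case_sum X (\<lambda>_. 0)), \<lambda>X. q (case_sum X (\<lambda>_. 0))}"
        and f = "if p x \<noteq> 0 then \<lambda>X. p (case_sum X (\<lambda>_. 0)) else (\<lambda>X. q (case_sum X (\<lambda>_. 0)))"
        and a = "\<lambda>c. x (Inl c)"])
    show "f \<in> poly_fun (game_coords n d)"
      if "f \<in> {\<lambda>X. p (case_sum X (\<lambda>_. 0)), \<lambda>X. q (case_sum X (\<lambda>_. 0))}" for f
      using that ext pq by blast
    show "(if p x \<noteq> 0 then \<lambda>X. p (case_sum X (\<lambda>_. 0)) else (\<lambda>X. q (case_sum X (\<lambda>_. 0))))
      \<in> {\<lambda>X. p (case_sum X (\<lambda>_. 0)), \<lambda>X. q (case_sum X (\<lambda>_. 0))}" by simp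
    show "(if p x \<noteq> 0 then \<lambda>X. p (case_sum X (\<lambda>_. 0)) else (\<lambda>X. q (case_sum X (\<lambda>_. 0)))) (\<lambda>c. x (Inl c)) \<noteq> 0"
      using x pq(3)[of x] val[OF pq(1)] val[OF pq(2)] by (auto simp: complex_eq_iff)
    fix X :: game and f
    assume "f \<in> {\<lambda>X. p (case_sum X (\<lambda>_. 0)), \<lambda>X. q (case_sum X (\<lambda>_. 0))}" "f X \<noteq> 0"
    then have "g (\<lambda>v. complex_of_real (case_sum X (\<lambda>_. 0) v)) \<noteq> 0"
      using pq(3)[of "case_sum X (\<lambda>_. 0)"] by (auto simp: complex_eq_iff)
    from gen[OF this] obtain u where
      u: "sol (\<lambda>v. if v \<in> U then u v else complex_of_real (case_sum X (\<lambda>_. 0) v))" by blast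
    have inl: "(\<lambda>v. if Inl v \<in> U then u (Inl v) else complex_of_real (case_sum X (\<lambda>_. 0) (Inl v))) =
        (\<lambda>v. complex_of_real (X v))"
      by (auto simp: U_def)
    show "spohn_CI_variety n d X G \<noteq> {}"
      by (rule solves_nonempty[OF K]) (rule u[unfolded sol_def inl])
  qed
qed

end

theorem theorem1p2:
  fixes n :: nat and d :: "nat \<Rightarrow> nat" and G :: "nat pair_pre_digraph"
  assumes "n \<ge> 1"
    and "\<And>i. i \<in> {1..n} \<Longrightarrow> d i \<ge> 2"
    and "pverts G = {1..n}"
    and "cluster_graph G"
  shows "holds_generically (game_coords n d) (\<lambda>X. spohn_CI_variety n d X G \<noteq> {}) \<longleftrightarrow>
    (\<forall>i\<in>isolated_vertices G.
       real (d i) \<le> 1 + 1 / 2 * (\<Sum>H\<in>components G. real (\<Prod>j\<in>verts H. d j) - 1))"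
proof -
  have ne: "pverts G \<noteq> {}" using assms(1,3) by simp
  note cluster = cluster_graph_components[OF assms(4) ne]
  interpret player_partition n d "max_cliques G"
    using assms(2,3) cluster(3-5) by unfold_locales auto
  let ?K = "max_cliques G"
  have card: "card (profiles d C) = (\<Prod>j\<in>C. d j)" if "C \<in> ?K" for C
    unfolding profiles_def using finite_block[OF that] by (simp add: card_PiE)
  have card_pos: "1 \<le> card (profiles d C)" if "C \<in> ?K" for C
    using one_in_profiles[OF that] finite_profiles[OF that] by (metis One_nat_def Suc_leI card_gt_0_iff empty_iff)
  have "(\<Sum>H\<in>components G. real (\<Prod>j\<in>verts H. d j) - 1) = (\<Sum>C\<in>?K. real (\<Prod>j\<in>C. d j) - 1)"
    unfolding cluster(1) using cluster(2) by (simp add: sum.reindex)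
  also have "\<dots> = real (\<Sum>C\<in>?K. card (profiles d C) - 1)"
    unfolding of_nat_sum using card card_pos by (intro sum.cong) (auto simp: of_nat_diff)
  finally have sum: "(\<Sum>H\<in>components G. real (\<Prod>j\<in>verts H. d j) - 1) =
    real (\<Sum>C\<in>?K. card (profiles d C) - 1)" .
  have iff: "real (d i) \<le> 1 + 1 / 2 * (\<Sum>H\<in>components G. real (\<Prod>j\<in>verts H. d j) - 1) \<longleftrightarrow>
    d i - 1 \<le> (\<Sum>C\<in>?K - {{i}}. card (profiles d C) - 1)" if i: "{i} \<in> ?K" for i
  proof -
    have "(\<Sum>C\<in>?K. card (profiles d C) - 1) = (d i - 1) + (\<Sum>C\<in>?K - {{i}}. card (profiles d C) - 1)"
      using sum.remove[OF finite_K i, of "\<lambda>C. card (profiles d C) - 1"] card[OF i] by simp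
    moreover have "2 \<le> d i" using d_ge_2 K_subset[OF i] by simp
    ultimately show ?thesis unfolding sum by linarith
  qed
  show ?thesis
  proof
    assume gen: "holds_generically (game_coords n d) (\<lambda>X. spohn_CI_variety n d X G \<noteq> {})"
    show "\<forall>i\<in>isolated_vertices G.
       real (d i) \<le> 1 + 1 / 2 * (\<Sum>H\<in>components G. real (\<Prod>j\<in>verts H. d j) - 1)"
    proof
      fix i assume "i \<in> isolated_vertices G"
      then have i: "{i} \<in> ?K" using cluster(6) by blast
      show "real (d i) \<le> 1 + 1 / 2 * (\<Sum>H\<in>components G. real (\<Prod>j\<in>verts H. d j) - 1)"
        using not_generically_nonempty[OF refl i] gen iff[OF i] by (meson not_le)
    qed
  next
    assume "\<forall>i\<in>isolated_vertices G.
       real (d i) \<le> 1 + 1 / 2 * (\<Sum>H\<in>components G. real (\<Prod>j\<in>verts H. d j) - 1)"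
    then show "holds_generically (game_coords n d) (\<lambda>X. spohn_CI_variety n d X G \<noteq> {})"
      using iff cluster(6) by (intro generically_nonempty) auto
  qed
qed

end
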